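(* Let $\mathcal{H}$ be an effective ample second countable Hausdorff groupoid whose unit space $\mathcal{H}^{(0)}$ is a locally compact Cantor space. If $\mathcal{H}$ is groupoid equivalent to $\mathcal{G}_E$ for some countable graph $E$ satisfying Condition (L) and having no sinks and no semi-tails, then there is an injective étale homomorphism $\mathcal{H}\hookrightarrow\mathcal{G}_{E_2}$. Moreover, if $\mathcal{H}^{(0)}$ is compact, then the embedding can be chosen to map $\mathcal{H}^{(0)}$ onto $E_2^\infty$.
   Context: Groupoid equivalence is the standard (Muhly–Renault–Williams) notion of equivalence of topological groupoids. A locally compact Cantor space is a non-empty second countable Hausdorff space with a basis of compact open sets and no isolated points. An étale homomorphism between étale groupoids is a groupoid homomorphism that is a local homeomorphism. Ample: étale with unit space Hausdorff having a basis of compact open sets; effective: the interior of $\{g: s(g)=r(g)\}$ is the unit space. Graph notation: $E=(E^0,E^1,r,s)$; finite paths $e_1\cdots e_n$ with $r(e_i)=s(e_{i+1})$; a sink is a vertex emitting no edges; singular vertices are sinks and vertices emitting infinitely many edges. Condition (L): every cycle (path of positive length with $r=s$) has an exit (an edge $e\ne e_i$ with $s(e)=s(e_i)$ for some edge $e_i$ of the cycle). An infinite path $e_1e_2\cdots$ is wandering if each vertex equals $s(e_i)$ for finitely many $i$; it is a semi-tail if it is wandering and $s(e_i)$ emits only the edge $e_i$ for all $i$. $\partial E=E^\infty\cup\{\mu: r(\mu)\text{ singular}\}$ with basis sets $Z(\mu)\setminus\bigcup_{e\in F}Z(\mu e)$, $Z(\mu)=\{\mu x\in\partial E\}$, $F$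 a finite set of edges from $r(\mu)$; $\sigma_E$ deletes the first edge. $\mathcal{G}_E=\{(x,m-n,y): |x|\ge m,|y|\ge n,\sigma_E^m(x)=\sigma_E^n(y)\}$, $(x,k,y)(y,l,z)=(x,k+l,z)$, $(x,k,y)^{-1}=(y,-k,x)$, unit space $\partial E$, topology generated by $\{(x,m-n,y): x\in U, y\in V,\sigma_E^m(x)=\sigma_E^n(y)\}$ for open $U,V$ on which $\sigma_E^m,\sigma_E^n$ are injective with $\sigma_E^m(U)=\sigma_E^n(V)$. $E_2$ is the graph with one vertex and two loops; $\partial E_2=E_2^\infty$ is the unit space of $\mathcal{G}_{E_2}$. *)

theory Defs
  imports "HOL-Analysis.Analysis" "HOL-Library.Extended_Nat"
begin

record 'g groupoid =
  arrows :: "'g set"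
  gsrc   :: "'g \<Rightarrow> 'g"
  grng   :: "'g \<Rightarrow> 'g"
  gcomp  :: "'g \<Rightarrow> 'g \<Rightarrow> 'g"   \<comment> \<open>gcomp g h = gh, defined when gsrc g = grng h\<close>
  ginv   :: "'g \<Rightarrow> 'g"
  gtop   :: "'g topology"

definition units :: "('g,'x) groupoid_scheme \<Rightarrow> 'g set" where
  "units G = gsrc G ` arrows G"

definition composable :: "('g,'x) groupoid_scheme \<Rightarrow> ('g \<times> 'g) set" where
  "composable G = {(g,h). g \<in> arrows G \<and> h \<in> arrows G \<and> gsrc G g = grng G h}"

definition is_groupoid :: "('g,'x) groupoid_scheme \<Rightarrow> bool" where
  "is_groupoid G \<longleftrightarrow>
     (\<forall>g\<in>arrows G. gsrc G g \<in> arrows G \<and> grng G g \<in> arrows G \<and> ginv G g \<in> arrows G) \<and>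
     (\<forall>u\<in>units G. gsrc G u = u \<and> grng G u = u) \<and>
     (\<forall>g\<in>arrows G. grng G g \<in> units G \<and>
                    gcomp G (grng G g) g = g \<and> gcomp G g (gsrc G g) = g) \<and>
     (\<forall>(g,h)\<in>composable G. gcomp G g h \<in> arrows G \<and>
          gsrc G (gcomp G g h) = gsrc G h \<and> grng G (gcomp G g h) = grng G g) \<and>
     (\<forall>g h k. (g,h) \<in> composable G \<longrightarrow> (h,k) \<in> composable G \<longrightarrow>
          gcomp G (gcomp G g h) k = gcomp G g (gcomp G h k)) \<and>
     (\<forall>g\<in>arrows G. gsrc G (ginv G g) = grng G g \<and> grng G (ginv G g) = gsrc G g \<and>
          gcomp G g (ginv G g) = grng G g \<and> gcomp G (ginv G g) g = gsrc G g)"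

definition top_groupoid :: "('g,'x) groupoid_scheme \<Rightarrow> bool" where
  "top_groupoid G \<longleftrightarrow> is_groupoid G \<and> topspace (gtop G) = arrows G \<and>
     continuous_map (gtop G) (gtop G) (gsrc G) \<and>
     continuous_map (gtop G) (gtop G) (grng G) \<and>
     continuous_map (gtop G) (gtop G) (ginv G) \<and>
     continuous_map (subtopology (prod_topology (gtop G) (gtop G)) (composable G)) (gtop G)
        (\<lambda>(g,h). gcomp G g h)"

definition unit_top :: "('g,'x) groupoid_scheme \<Rightarrow> 'g topology" where
  "unit_top G = subtopology (gtop G) (units G)"

definition local_homeo :: "'a topology \<Rightarrow> 'b topology \<Rightarrow> ('a \<Rightarrow> 'b) \<Rightarrow> bool" where
  "local_homeo X Y f \<longleftrightarrow> f ` topspace X \<subseteq> topspace Y \<and>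
     (\<forall>x\<in>topspace X. \<exists>U. openin X U \<and> x \<in> U \<and> openin Y (f ` U) \<and>
        homeomorphic_map (subtopology X U) (subtopology Y (f ` U)) f)"

definition compact_open_basis :: "'a topology \<Rightarrow> bool" where
  "compact_open_basis X \<longleftrightarrow> (\<forall>U x. openin X U \<and> x \<in> U \<longrightarrow>
      (\<exists>V. openin X V \<and> compactin X V \<and> x \<in> V \<and> V \<subseteq> U))"

definition etale :: "('g,'x) groupoid_scheme \<Rightarrow> bool" where
  "etale G \<longleftrightarrow> top_groupoid G \<and> local_homeo (gtop G) (unit_top G) (gsrc G)"

definition ample :: "('g,'x) groupoid_scheme \<Rightarrow> bool" where
  "ample G \<longleftrightarrow> etale G \<and> Hausdorff_space (unit_top G) \<and> compact_open_basis (unit_top G)"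

definition isotropy :: "('g,'x) groupoid_scheme \<Rightarrow> 'g set" where
  "isotropy G = {g\<in>arrows G. gsrc G g = grng G g}"

definition effective :: "('g,'x) groupoid_scheme \<Rightarrow> bool" where
  "effective G \<longleftrightarrow> (gtop G) interior_of (isotropy G) = units G"

definition lc_cantor :: "'a topology \<Rightarrow> bool" where
  "lc_cantor X \<longleftrightarrow> topspace X \<noteq> {} \<and> second_countable X \<and> Hausdorff_space X \<and>
     compact_open_basis X \<and> (\<forall>x\<in>topspace X. \<not> openin X {x})"

definition groupoid_hom ::
  "('g,'x) groupoid_scheme \<Rightarrow> ('k,'y) groupoid_scheme \<Rightarrow> ('g \<Rightarrow> 'k) \<Rightarrow> bool" where
  "groupoid_hom G K \<phi> \<longleftrightarrow> \<phi> ` arrows G \<subseteq> arrows K \<and>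
     (\<forall>(g,h)\<in>composable G. gsrc K (\<phi> g) = grng K (\<phi> h) \<and>
        \<phi> (gcomp G g h) = gcomp K (\<phi> g) (\<phi> h))"

definition etale_hom ::
  "('g,'x) groupoid_scheme \<Rightarrow> ('k,'y) groupoid_scheme \<Rightarrow> ('g \<Rightarrow> 'k) \<Rightarrow> bool" where
  "etale_hom G K \<phi> \<longleftrightarrow> groupoid_hom G K \<phi> \<and> local_homeo (gtop G) (gtop K) \<phi>"

section \<open>Groupoid equivalence (Muhly--Renault--Williams)\<close>

definition proper_mrw :: "'a topology \<Rightarrow> 'b topology \<Rightarrow> ('a \<Rightarrow> 'b) \<Rightarrow> bool" where
  "proper_mrw X Y f \<longleftrightarrow> (\<forall>K. compactin Y K \<longrightarrow> compactin X {x\<in>topspace X. f x \<in> K})"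

definition left_dom :: "('g,'x) groupoid_scheme \<Rightarrow> 'z topology \<Rightarrow> ('z \<Rightarrow> 'g) \<Rightarrow> ('g \<times> 'z) set" where
  "left_dom G Z rho = {(g,z). g \<in> arrows G \<and> z \<in> topspace Z \<and> gsrc G g = rho z}"

definition right_dom :: "('h,'x) groupoid_scheme \<Rightarrow> 'z topology \<Rightarrow> ('z \<Rightarrow> 'h) \<Rightarrow> ('z \<times> 'h) set" where
  "right_dom H Z sig = {(z,h). z \<in> topspace Z \<and> h \<in> arrows H \<and> sig z = grng H h}"

definition principal_left_space ::
  "('g,'x) groupoid_scheme \<Rightarrow> 'z topology \<Rightarrow> ('z \<Rightarrow> 'g) \<Rightarrow> ('g \<Rightarrow> 'z \<Rightarrow> 'z) \<Rightarrow> bool" where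
  "principal_left_space G Z rho act \<longleftrightarrow>
     continuous_map Z (unit_top G) rho \<and> open_map Z (unit_top G) rho \<and>
     continuous_map (subtopology (prod_topology (gtop G) Z) (left_dom G Z rho)) Z
        (\<lambda>(g,z). act g z) \<and>
     (\<forall>(g,z)\<in>left_dom G Z rho. act g z \<in> topspace Z \<and> rho (act g z) = grng G g) \<and>
     (\<forall>z\<in>topspace Z. act (rho z) z = z) \<and>
     (\<forall>g h z. (g,h) \<in> composable G \<longrightarrow> (h,z) \<in> left_dom G Z rho \<longrightarrow>
        act (gcomp G g h) z = act g (act h z)) \<and>
     (\<forall>(g,z)\<in>left_dom G Z rho. act g z = z \<longrightarrow> g \<in> units G) \<and>
     proper_mrw (subtopology (prod_topology (gtop G) Z) (left_dom G Z rho))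
        (prod_topology Z Z) (\<lambda>(g,z). (act g z, z))"

definition principal_right_space ::
  "('h,'x) groupoid_scheme \<Rightarrow> 'z topology \<Rightarrow> ('z \<Rightarrow> 'h) \<Rightarrow> ('z \<Rightarrow> 'h \<Rightarrow> 'z) \<Rightarrow> bool" where
  "principal_right_space H Z sig act \<longleftrightarrow>
     continuous_map Z (unit_top H) sig \<and> open_map Z (unit_top H) sig \<and>
     continuous_map (subtopology (prod_topology Z (gtop H)) (right_dom H Z sig)) Z
        (\<lambda>(z,h). act z h) \<and>
     (\<forall>(z,h)\<in>right_dom H Z sig. act z h \<in> topspace Z \<and> sig (act z h) = gsrc H h) \<and>
     (\<forall>z\<in>topspace Z. act z (sig z) = z) \<and>
     (\<forall>z h k. (z,h) \<in> right_dom H Z sig \<longrightarrow> (h,k) \<in> composable H \<longrightarrow>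
        act z (gcomp H h k) = act (act z h) k) \<and>
     (\<forall>(z,h)\<in>right_dom H Z sig. act z h = z \<longrightarrow> h \<in> units H) \<and>
     proper_mrw (subtopology (prod_topology Z (gtop H)) (right_dom H Z sig))
        (prod_topology Z Z) (\<lambda>(z,h). (z, act z h))"

text \<open>Z is a (G,H)-equivalence: (i),(ii) principal spaces, (iii) commuting actions,
  (iv) rho induces a homeomorphism Z/H \<cong> G0, (v) sig induces G\Z \<cong> H0
  (expressed as: the moment map is a quotient map whose fibres are exactly the orbits).\<close>
definition groupoid_equivalence ::
  "('g,'x) groupoid_scheme \<Rightarrow> ('h,'y) groupoid_scheme \<Rightarrow> 'z topology \<Rightarrow>
   ('z \<Rightarrow> 'g) \<Rightarrow> ('g \<Rightarrow> 'z \<Rightarrow> 'z) \<Rightarrow> ('z \<Rightarrow> 'h) \<Rightarrow> ('z \<Rightarrow> 'h \<Rightarrow> 'z) \<Rightarrow> bool" where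
  "groupoid_equivalence G H Z rho lact sig ract \<longleftrightarrow>
     top_groupoid G \<and> top_groupoid H \<and>
     Hausdorff_space Z \<and> locally_compact_space Z \<and>
     principal_left_space G Z rho lact \<and> principal_right_space H Z sig ract \<and>
     (\<forall>(g,z)\<in>left_dom G Z rho. sig (lact g z) = sig z) \<and>
     (\<forall>(z,h)\<in>right_dom H Z sig. rho (ract z h) = rho z) \<and>
     (\<forall>g z h. (g,z) \<in> left_dom G Z rho \<longrightarrow> (z,h) \<in> right_dom H Z sig \<longrightarrow>
        ract (lact g z) h = lact g (ract z h)) \<and>
     quotient_map Z (unit_top G) rho \<and>
     (\<forall>z\<in>topspace Z. \<forall>w\<in>topspace Z. rho z = rho w \<longleftrightarrow>
        (\<exists>h. (z,h) \<in> right_dom H Z sig \<and> ract z h = w)) \<and>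
     quotient_map Z (unit_top H) sig \<and>
     (\<forall>z\<in>topspace Z. \<forall>w\<in>topspace Z. sig z = sig w \<longleftrightarrow>
        (\<exists>g. (g,z) \<in> left_dom G Z rho \<and> lact g z = w))"

record ('v,'e) graph =
  verts   :: "'v set"
  edges   :: "'e set"
  grange  :: "'e \<Rightarrow> 'v"
  gsource :: "'e \<Rightarrow> 'v"

definition countable_graph :: "('v,'e) graph \<Rightarrow> bool" where
  "countable_graph E \<longleftrightarrow> countable (verts E) \<and> countable (edges E) \<and>
     (\<forall>e\<in>edges E. grange E e \<in> verts E \<and> gsource E e \<in> verts E)"

definition fin_path :: "('v,'e) graph \<Rightarrow> 'v \<Rightarrow> 'e list \<Rightarrow> bool" where
  "fin_path E v es \<longleftrightarrow> v \<in> verts E \<and> set es \<subseteq> edges E \<and>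
     (es \<noteq> [] \<longrightarrow> gsource E (hd es) = v) \<and>
     (\<forall>i. Suc i < length es \<longrightarrow> grange E (es ! i) = gsource E (es ! Suc i))"

definition prange :: "('v,'e) graph \<Rightarrow> 'v \<Rightarrow> 'e list \<Rightarrow> 'v" where
  "prange E v es = (if es = [] then v else grange E (last es))"

definition inf_path :: "('v,'e) graph \<Rightarrow> (nat \<Rightarrow> 'e) \<Rightarrow> bool" where
  "inf_path E f \<longleftrightarrow> (\<forall>i. f i \<in> edges E \<and> grange E (f i) = gsource E (f (Suc i)))"

definition emits :: "('v,'e) graph \<Rightarrow> 'v \<Rightarrow> 'e set" where
  "emits E v = {e\<in>edges E. gsource E e = v}"

definition singular :: "('v,'e) graph \<Rightarrow> 'v \<Rightarrow> bool" where
  "singular E v \<longleftrightarrow> emits E v = {} \<or> infinite (emits E v)"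

definition condition_L :: "('v,'e) graph \<Rightarrow> bool" where
  "condition_L E \<longleftrightarrow> (\<forall>v es. fin_path E v es \<and> es \<noteq> [] \<and> prange E v es = v \<longrightarrow>
     (\<exists>i<length es. \<exists>e\<in>edges E. e \<noteq> es ! i \<and> gsource E e = gsource E (es ! i)))"

definition no_sinks :: "('v,'e) graph \<Rightarrow> bool" where
  "no_sinks E \<longleftrightarrow> (\<forall>v\<in>verts E. emits E v \<noteq> {})"

definition wandering :: "('v,'e) graph \<Rightarrow> (nat \<Rightarrow> 'e) \<Rightarrow> bool" where
  "wandering E f \<longleftrightarrow> inf_path E f \<and> (\<forall>v. finite {i. gsource E (f i) = v})"

definition semi_tail :: "('v,'e) graph \<Rightarrow> (nat \<Rightarrow> 'e) \<Rightarrow> bool" where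
  "semi_tail E f \<longleftrightarrow> wandering E f \<and> (\<forall>i. emits E (gsource E (f i)) = {f i})"

definition no_semi_tails :: "('v,'e) graph \<Rightarrow> bool" where
  "no_semi_tails E \<longleftrightarrow> \<not> (\<exists>f. semi_tail E f)"

text \<open>Paths: a finite path is its source vertex plus its edge list; infinite paths.\<close>
datatype ('v,'e) bpath = FinP 'v "'e list" | InfP "nat \<Rightarrow> 'e"

fun plen :: "('v,'e) bpath \<Rightarrow> enat" where
  "plen (FinP v es) = enat (length es)"
| "plen (InfP f) = \<infinity>"

text \<open>The shift map sigma_E (deletes the first edge; identity on vertices, never used there).\<close>
fun shift :: "('v,'e) graph \<Rightarrow> ('v,'e) bpath \<Rightarrow> ('v,'e) bpath" where
  "shift E (FinP v []) = FinP v []"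
| "shift E (FinP v (e # es)) = FinP (grange E e) es"
| "shift E (InfP f) = InfP (\<lambda>i. f (Suc i))"

definition bdry :: "('v,'e) graph \<Rightarrow> ('v,'e) bpath set" where
  "bdry E = {FinP v es | v es. fin_path E v es \<and> singular E (prange E v es)} \<union>
            {InfP f | f. inf_path E f}"

fun is_pref :: "('v,'e) graph \<Rightarrow> 'v \<Rightarrow> 'e list \<Rightarrow> ('v,'e) bpath \<Rightarrow> bool" where
  "is_pref E v es (FinP w ds) \<longleftrightarrow> w = v \<and> take (length es) ds = es"
| "is_pref E v es (InfP f) \<longleftrightarrow> gsource E (f 0) = v \<and> (\<forall>i<length es. f i = es ! i)"

definition cyl :: "('v,'e) graph \<Rightarrow> 'v \<Rightarrow> 'e list \<Rightarrow> ('v,'e) bpath set" where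
  "cyl E v es = {x\<in>bdry E. is_pref E v es x}"

definition bdry_basis :: "('v,'e) graph \<Rightarrow> ('v,'e) bpath set set" where
  "bdry_basis E = {cyl E v es - (\<Union>e\<in>F. cyl E v (es @ [e])) | v es F.
      fin_path E v es \<and> finite F \<and> F \<subseteq> emits E (prange E v es)}"

definition bdry_top :: "('v,'e) graph \<Rightarrow> ('v,'e) bpath topology" where
  "bdry_top E = topology_generated_by (bdry_basis E)"

type_synonym ('v,'e) gg_arrow = "('v,'e) bpath \<times> int \<times> ('v,'e) bpath"

definition gg_arrows :: "('v,'e) graph \<Rightarrow> ('v,'e) gg_arrow set" where
  "gg_arrows E = {(x, int m - int n, y) | x y m n. x \<in> bdry E \<and> y \<in> bdry E \<and>
      enat m \<le> plen x \<and> enat n \<le> plen y \<and> (shift E ^^ m) x = (shift E ^^ n) y}"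

definition gg_basic_opens :: "('v,'e) graph \<Rightarrow> ('v,'e) gg_arrow set set" where
  "gg_basic_opens E = {{(x, int m - int n, y) | x y. x \<in> U \<and> y \<in> V \<and>
         (shift E ^^ m) x = (shift E ^^ n) y} | U V m n.
      openin (bdry_top E) U \<and> openin (bdry_top E) V \<and>
      (\<forall>x\<in>U. enat m \<le> plen x) \<and> (\<forall>y\<in>V. enat n \<le> plen y) \<and>
      inj_on (shift E ^^ m) U \<and> inj_on (shift E ^^ n) V \<and>
      (shift E ^^ m) ` U = (shift E ^^ n) ` V}"

definition graph_groupoid :: "('v,'e) graph \<Rightarrow> ('v,'e) gg_arrow groupoid" where
  "graph_groupoid E = \<lparr> arrows = gg_arrows E,
     gsrc = (\<lambda>(x,k,y). (y,0,y)),
     grng = (\<lambda>(x,k,y). (x,0,x)),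
     gcomp = (\<lambda>(x,k,y) (y',l,z). (x,k+l,z)),
     ginv = (\<lambda>(x,k,y). (y,-k,x)),
     gtop = topology_generated_by (gg_basic_opens E) \<rparr>"

definition E2 :: "(unit, bool) graph" where
  "E2 = \<lparr> verts = {()}, edges = UNIV, grange = (\<lambda>_. ()), gsource = (\<lambda>_. ()) \<rparr>"

end

theory Submission
  imports Defs
begin

text \<open>
  Choose a prefix-free code on the edges leaving each vertex, complete when the vertex emits finitely
  many edges.  Concatenating code words maps the boundary paths starting at a fixed vertex
  homeomorphically onto the Cantor set of binary sequences: a finite path ending at an infinite
  emitter is sent to its word followed by an infinite string of ones, and no infinite path is
  sent to a finite word because Condition (L) and the absence of semi-tails prevent all its edges
  from having empty code.  This coding intertwines the shifts up to a change of lag, so it extends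
  to a homomorphism of groupoids, and aperiodicity of the lags makes it faithful on isotropy.

  For an equivalence bispace Z both moment maps are local homeomorphisms, because the orbit maps
  are closed and the units are open.  A locally defined section of the moment map onto the unit space
  of H then turns H into a pullback of the graph groupoid along a local homeomorphism f.  It remains
  to make f composed with the coding injective: cut the unit space into countably many clopen pieces
  each mapped bijectively onto a cylinder, and replace the words of these cylinders by the words of
  one further prefix-free code, complete if there are only finitely many pieces.
\<close>

section \<open>Binary sequences and prefix codes\<close>

text \<open>An arrow of \<open>graph_groupoid E2\<close> is two binary sequences and a lag, so the
  embedding consists of an injective coding \<open>\<beta>\<close> of the units and an integer
  cocycle \<open>c\<close>; it is faithful when \<open>c\<close> separates arrows with equal range
  and source. Two obstacles shape the construction. Each vertex already fills the whole Cantor set,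
  so the coding of paths separates only paths with a common source, and \<open>f\<close> itself is
  only locally injective. Pieces of the unit space therefore have to lie over a single vertex before
  they are recoded. Further, lags change: deleting \<open>m\<close> edges of \<open>x\<close>
  deletes \<open>alen E x m\<close> letters, so an arrow from \<open>y\<close> to \<open>x\<close>
  with lag \<open>m - n\<close> acquires the lag \<open>alen E x m - alen E y n\<close>, independent
  of the pair chosen. Recoding exchanges \<open>a u\<close> letters for \<open>b u\<close> letters
  and adds the coboundary of \<open>b - a\<close>. Different lags could collapse only along a cycle
  whose word is empty, that is, one without exit.\<close>

definition seq_open :: "(nat \<Rightarrow> bool) set \<Rightarrow> bool" where
  "seq_open U \<longleftrightarrow> (\<forall>x\<in>U. \<exists>n. \<forall>y. (\<forall>i<n. y i = x i) \<longrightarrow> y \<in> U)"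

definition word_prefix :: "bool list \<Rightarrow> (nat \<Rightarrow> bool) \<Rightarrow> bool" where
  "word_prefix w x \<longleftrightarrow> (\<forall>i<length w. x i = w ! i)"

text \<open>The words are 0, 10, 110, and so on, with 1 for True; in a finite set the last word loses its
  final 0 and the code becomes complete, so a one-element set is coded by the empty word.\<close>
definition code :: "'a set \<Rightarrow> 'a \<Rightarrow> bool list" where
  "code S e = replicate (to_nat_on S e) True @
     (if finite S \<and> Suc (to_nat_on S e) = card S then [] else [False])"

lemma word_prefix_Nil [simp]: "word_prefix [] x"
  by (simp add: word_prefix_def)

lemma word_prefix_append: "word_prefix (u @ w) x \<longleftrightarrow> word_prefix u x \<and> word_prefix w (\<lambda>i. x (i + length u))"
proof
  assume *: "word_prefix (u @ w) x"
  have "x i = u ! i" if "i < length u" for i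
    using *[unfolded word_prefix_def, rule_format, of i] that by (simp add: nth_append)
  moreover have "x (i + length u) = w ! i" if "i < length w" for i
    using *[unfolded word_prefix_def, rule_format, of "i + length u"] that by (simp add: nth_append)
  ultimately show "word_prefix u x \<and> word_prefix w (\<lambda>i. x (i + length u))" by (auto simp: word_prefix_def)
next
  assume *: "word_prefix u x \<and> word_prefix w (\<lambda>i. x (i + length u))"
  have "x i = (u @ w) ! i" if "i < length (u @ w)" for i
  proof (cases "i < length u")
    case True
    then show ?thesis using * by (simp add: nth_append word_prefix_def)
  next
    case False
    then show ?thesis using *[unfolded word_prefix_def] that
      by (auto simp: nth_append dest!: spec[of _ "i - length u"])
  qed
  then show "word_prefix (u @ w) x" by (simp add: word_prefix_def)
qed

lemma to_nat_on_less_card: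
  assumes "finite S" "e \<in> S" shows "to_nat_on S e < card S"
  using to_nat_on_finite[OF assms(1)] assms(2) by (auto simp: bij_betw_def)

lemma ex_to_nat_on_infinite:
  assumes "countable S" "infinite S" shows "\<exists>e\<in>S. to_nat_on S e = k"
  using to_nat_on_infinite[OF assms] by (metis UNIV_I bij_betw_imp_surj_on imageE)

lemma ex_to_nat_on_finite:
  assumes "finite S" "k < card S" shows "\<exists>e\<in>S. to_nat_on S e = k"
  using to_nat_on_finite[OF assms(1)] assms(2)
  by (metis bij_betw_imp_surj_on imageE lessThan_iff)

text \<open>Let the number of \<open>e\<close> be the smaller one. It is not the last number, so the
  word of \<open>e\<close> has its 0 at a position where the word of \<open>d\<close> still has a
  1.\<close>

lemma code_inj:
  assumes "countable S" "e \<in> S" "d \<in> S" "word_prefix (code S e) x" "word_prefix (code S d) x"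
  shows "e = d"
proof -
  have *: False if "e \<in> S" "d \<in> S" "word_prefix (code S e) x" "word_prefix (code S d) x"
    "to_nat_on S e < to_nat_on S d" for e d
  proof -
    have "\<not> (finite S \<and> Suc (to_nat_on S e) = card S)"
      using to_nat_on_less_card[of S d] that by auto
    then have "\<not> x (to_nat_on S e)"
      using that(3) by (auto simp: code_def word_prefix_def nth_append dest: spec[of _ "to_nat_on S e"])
    moreover have "x (to_nat_on S e)"
      using that(4)[unfolded word_prefix_def code_def, rule_format, of "to_nat_on S e"] that(5)
      by (simp add: nth_append)
    ultimately show False by simp
  qed
  have "to_nat_on S e = to_nat_on S d"
    using *[of e d] *[of d e] assms by (meson nat_neq_iff)
  then show ?thesis using assms by (simp add: to_nat_on_inj)
qed

text \<open>The position of the first 0 of \<open>x\<close> names the element whose word begins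
  \<open>x\<close>. If this position is at or beyond the last number of a finite \<open>S\<close>,
  the last word, which has no 0, takes over; if there is no 0 at all, only a finite \<open>S\<close>
  has a word for \<open>x\<close>.\<close>

lemma code_total:
  assumes "countable S" "S \<noteq> {}"
  shows "(\<exists>e\<in>S. word_prefix (code S e) x) \<or> infinite S \<and> (\<forall>i. x i)"
proof (cases "\<exists>k. \<not> x k")
  case True
  define k where "k = (LEAST k. \<not> x k)"
  have k: "\<not> x k" and k': "\<And>i. i < k \<Longrightarrow> x i"
    unfolding k_def using LeastI_ex[OF True] by (auto dest: not_less_Least)
  show ?thesis
  proof (cases "finite S \<and> card S \<le> Suc k")
    case True
    then have "card S - 1 < card S" using assms by (auto simp: card_gt_0_iff)
    then obtain e where e: "e \<in> S" "to_nat_on S e = card S - 1"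
      using ex_to_nat_on_finite True by blast
    then have "code S e = replicate (card S - 1) True"
      using True assms by (auto simp: code_def card_gt_0_iff)
    then have "word_prefix (code S e) x" using k' True by (auto simp: word_prefix_def)
    then show ?thesis using e by blast
  next
    case False
    then have "finite S \<Longrightarrow> k < card S" by auto
    then obtain e where e: "e \<in> S" "to_nat_on S e = k"
      using ex_to_nat_on_finite[of S k] ex_to_nat_on_infinite[OF assms(1), of k] by blast
    then have "code S e = replicate k True @ [False]"
      using False by (auto simp: code_def)
    then have "word_prefix (code S e) x" using k k' by (auto simp: word_prefix_def nth_append less_Suc_eq)
    then show ?thesis using e by blast
  qed
next
  case False
  show ?thesis
  proof (cases "finite S")
    case True
    then have "card S - 1 < card S" using assms by (auto simp: card_gt_0_iff)
    then obtain e where e: "e \<in> S" "to_nat_on S e = card S - 1"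
      using ex_to_nat_on_finite True by blast
    then have "code S e = replicate (card S - 1) True"
      using True assms by (auto simp: code_def card_gt_0_iff)
    then have "word_prefix (code S e) x" using False by (auto simp: word_prefix_def)
    then show ?thesis using e by blast
  qed (use False in auto)
qed

text \<open>Applied to the edges leaving a vertex, this says that an edge with empty word is the
  only one its source emits.\<close>

lemma code_eq_Nil:
  assumes "countable S" "e \<in> S" "code S e = []" shows "S = {e}"
proof -
  have "finite S" "card S = 1" using assms by (auto simp: code_def split: if_splits)
  then show ?thesis using assms(2) card_1_singletonE by blast
qed

text \<open>For infinite \<open>S\<close> every word ends in 0. This separates a finite path, whose
  coded tail is constantly 1, from its extensions.\<close>

lemma code_infinite_has_False:
  assumes "infinite S" "word_prefix (code S e) x" shows "\<exists>i. \<not> x i"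
  using assms by (intro exI[of _ "to_nat_on S e"]) (auto simp: code_def word_prefix_def nth_append)

text \<open>All words but finitely many start with \<open>n\<close> ones. The exceptions are the
  edges to be removed from a cylinder to get a neighbourhood of a finite path on which further
  letters stay constant.\<close>

lemma finite_short_codes:
  assumes "countable S" "infinite S"
  shows "finite {e\<in>S. \<not> (\<forall>x. word_prefix (code S e) x \<longrightarrow> (\<forall>i<n. x i))}"
proof (rule finite_subset)
  show "{e\<in>S. \<not> (\<forall>x. word_prefix (code S e) x \<longrightarrow> (\<forall>i<n. x i))} \<subseteq> {e\<in>S. to_nat_on S e < n}"
    using assms(2)
    by (auto simp: code_def word_prefix_def nth_append) (meson not_less less_le_trans)
  have "inj_on (to_nat_on S) {e\<in>S. to_nat_on S e < n}"
    using inj_on_to_nat_on[OF assms(1)] by (rule inj_on_subset) auto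
  moreover have "to_nat_on S ` {e\<in>S. to_nat_on S e < n} \<subseteq> {..<n}" by auto
  ultimately show "finite {e\<in>S. to_nat_on S e < n}"
    using finite_subset finite_imageD by (metis finite_lessThan)
qed

section \<open>Open sets of binary sequences\<close>

lemma seq_open_Int: "seq_open U \<Longrightarrow> seq_open V \<Longrightarrow> seq_open (U \<inter> V)"
  unfolding seq_open_def
proof (intro ballI)
  fix x assume *: "\<forall>x\<in>U. \<exists>n. \<forall>y. (\<forall>i<n. y i = x i) \<longrightarrow> y \<in> U"
     "\<forall>x\<in>V. \<exists>n. \<forall>y. (\<forall>i<n. y i = x i) \<longrightarrow> y \<in> V" and x: "x \<in> U \<inter> V"
  obtain n where "\<forall>y. (\<forall>i<n. y i = x i) \<longrightarrow> y \<in> U" using *(1) x by blast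
  moreover obtain m where "\<forall>y. (\<forall>i<m. y i = x i) \<longrightarrow> y \<in> V" using *(2) x by blast
  ultimately show "\<exists>n. \<forall>y. (\<forall>i<n. y i = x i) \<longrightarrow> y \<in> U \<inter> V"
    by (intro exI[of _ "max n m"]) auto
qed

lemma seq_open_Union: "(\<And>U. U \<in> \<U> \<Longrightarrow> seq_open U) \<Longrightarrow> seq_open (\<Union>\<U>)"
  unfolding seq_open_def
proof
  fix x assume *: "\<And>U. U \<in> \<U> \<Longrightarrow> \<forall>x\<in>U. \<exists>n. \<forall>y. (\<forall>i<n. y i = x i) \<longrightarrow> y \<in> U" and "x \<in> \<Union>\<U>"
  then obtain U where U: "U \<in> \<U>" "x \<in> U" by blast
  then obtain n where "\<forall>y. (\<forall>i<n. y i = x i) \<longrightarrow> y \<in> U" using * by blast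
  then show "\<exists>n. \<forall>y. (\<forall>i<n. y i = x i) \<longrightarrow> y \<in> \<Union>\<U>" using U by blast
qed

lemma seq_open_word_prefix: "seq_open {x. word_prefix w x}"
  unfolding seq_open_def word_prefix_def by (auto intro!: exI[of _ "length w"])

lemma seq_open_not_word_prefix: "seq_open {x. \<not> word_prefix w x}"
  unfolding seq_open_def
proof
  fix x assume "x \<in> {x. \<not> word_prefix w x}"
  then have "\<not> word_prefix w y" if "\<forall>i<length w. y i = x i" for y
    using that by (auto simp: word_prefix_def)
  then show "\<exists>n. \<forall>y. (\<forall>i<n. y i = x i) \<longrightarrow> y \<in> {x. \<not> word_prefix w x}" by blast
qed

lemma seq_open_Diff_word_prefix:
  assumes "seq_open U" "finite W" shows "seq_open (U - (\<Union>w\<in>W. {x. word_prefix w x}))"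
  using assms(2)
proof (induction W)
  case (insert w W)
  have "U - (\<Union>w\<in>insert w W. {x. word_prefix w x}) = (U - (\<Union>w\<in>W. {x. word_prefix w x})) \<inter> {x. \<not> word_prefix w x}"
    by auto
  then show ?case using seq_open_Int[OF insert.IH seq_open_not_word_prefix] by simp
qed (use assms in simp)

section \<open>Embedding etale groupoids by cocycles\<close>

lemma bdry_E2: "bdry E2 = range InfP"
  by (auto simp: bdry_def singular_def emits_def E2_def inf_path_def)

lemma shift_InfP: "(shift E ^^ m) (InfP f) = InfP (\<lambda>i. f (i + m))"
  by (induction m arbitrary: f) (auto simp: funpow_swap1)

lemma cyl_E2: "cyl E2 v es = InfP ` {x. word_prefix es x}"
  by (auto simp: cyl_def bdry_E2 word_prefix_def E2_def[THEN arg_cong, of gsource, simplified])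

text \<open>Reduces the boundary topology of \<open>E2\<close> to prefix conditions: its cylinders
  are word cylinders, and these are also closed, so deleting finitely many keeps a basic set
  open.\<close>

lemma openin_bdry_E2: "openin (bdry_top E2) U \<longleftrightarrow> (\<exists>V. U = InfP ` V \<and> seq_open V)"
proof
  assume "openin (bdry_top E2) U"
  then have "generate_topology_on (bdry_basis E2) U"
    by (simp add: bdry_top_def openin_topology_generated_by_iff)
  then show "\<exists>V. U = InfP ` V \<and> seq_open V"
  proof induction
    case Empty
    show ?case by (auto simp: seq_open_def)
  next
    case (Int a b)
    then obtain V W where "a = InfP ` V" "b = InfP ` W" "seq_open V" "seq_open W" by blast
    then show ?case by (intro exI[of _ "V \<inter> W"]) (auto intro: seq_open_Int)
  next
    case (UN K)
    then have *: "\<exists>V. k = InfP ` V \<and> seq_open V" if "k \<in> K" for k using that by blast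
    \<comment> \<open>Taking all admissible preimages avoids choosing one for each member of
      \<open>K\<close>.\<close>
    then show ?case
      by (intro exI[of _ "\<Union>{V. InfP ` V \<in> K \<and> seq_open V}"] conjI seq_open_Union) (auto, blast)
  next
    case (Basis s)
    then obtain v es F where s: "s = cyl E2 v es - (\<Union>e\<in>F. cyl E2 v (es @ [e]))" "finite F"
      by (auto simp: bdry_basis_def)
    have "s = InfP ` ({x. word_prefix es x} - (\<Union>w\<in>(\<lambda>e. es @ [e]) ` F. {x. word_prefix w x}))"
      unfolding s(1) cyl_E2 by auto
    moreover have "seq_open ({x. word_prefix es x} - (\<Union>w\<in>(\<lambda>e. es @ [e]) ` F. {x. word_prefix w x}))"
      by (rule seq_open_Diff_word_prefix[OF seq_open_word_prefix]) (use s(2) in simp)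
    ultimately show ?case by blast
  qed
next
  assume "\<exists>V. U = InfP ` V \<and> seq_open V"
  then obtain V where V: "U = InfP ` V" "seq_open V" by blast
  have "\<exists>T. openin (bdry_top E2) T \<and> y \<in> T \<and> T \<subseteq> U" if y: "y \<in> U" for y
  proof -
    obtain x where x: "x \<in> V" "y = InfP x" using y V(1) by blast
    then obtain n where n: "\<And>y. (\<forall>i<n. y i = x i) \<Longrightarrow> y \<in> V" using V(2) unfolding seq_open_def by blast
    let ?w = "map x [0..<n]"
    have "cyl E2 () ?w \<in> bdry_basis E2"
      unfolding bdry_basis_def by clarsimp
        (rule exI[of _ "?w"], rule exI[of _ "{}"], auto simp: fin_path_def E2_def)
    then have "openin (bdry_top E2) (cyl E2 () ?w)"
      unfolding bdry_top_def by (rule topology_generated_by_Basis)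
    moreover have "y \<in> cyl E2 () ?w" "cyl E2 () ?w \<subseteq> U"
      using x n by (auto simp: cyl_E2 word_prefix_def V(1))
    ultimately show ?thesis by blast
  qed
  then show "openin (bdry_top E2) U" by (subst openin_subopen) blast
qed

section \<open>Groupoid identities and charts of etale groupoids\<close>

lemma is_groupoidD:
  assumes "is_groupoid G"
  shows "g \<in> arrows G \<Longrightarrow> gsrc G g \<in> units G" "g \<in> arrows G \<Longrightarrow> grng G g \<in> units G"
    "g \<in> arrows G \<Longrightarrow> ginv G g \<in> arrows G"
    "u \<in> units G \<Longrightarrow> u \<in> arrows G" "u \<in> units G \<Longrightarrow> gsrc G u = u" "u \<in> units G \<Longrightarrow> grng G u = u"
    "g \<in> arrows G \<Longrightarrow> gcomp G (grng G g) g = g" "g \<in> arrows G \<Longrightarrow> gcomp G g (gsrc G g) = g"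
    "(g,h) \<in> composable G \<Longrightarrow> gcomp G g h \<in> arrows G"
    "(g,h) \<in> composable G \<Longrightarrow> gsrc G (gcomp G g h) = gsrc G h"
    "(g,h) \<in> composable G \<Longrightarrow> grng G (gcomp G g h) = grng G g"
    "(g,h) \<in> composable G \<Longrightarrow> (h,k) \<in> composable G \<Longrightarrow>
       gcomp G (gcomp G g h) k = gcomp G g (gcomp G h k)"
    "g \<in> arrows G \<Longrightarrow> gsrc G (ginv G g) = grng G g" "g \<in> arrows G \<Longrightarrow> grng G (ginv G g) = gsrc G g"
    "g \<in> arrows G \<Longrightarrow> gcomp G g (ginv G g) = grng G g" "g \<in> arrows G \<Longrightarrow> gcomp G (ginv G g) g = gsrc G g"
proof -
  note G = assms[unfolded is_groupoid_def]
  show "g \<in> arrows G \<Longrightarrow> gsrc G g \<in> units G" by (simp add: units_def)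
  show "u \<in> units G \<Longrightarrow> u \<in> arrows G" using conjunct1[OF G] by (auto simp: units_def)
  show "u \<in> units G \<Longrightarrow> gsrc G u = u" "u \<in> units G \<Longrightarrow> grng G u = u" using G by simp_all
  show "g \<in> arrows G \<Longrightarrow> grng G g \<in> units G" "g \<in> arrows G \<Longrightarrow> ginv G g \<in> arrows G"
    "g \<in> arrows G \<Longrightarrow> gcomp G (grng G g) g = g" "g \<in> arrows G \<Longrightarrow> gcomp G g (gsrc G g) = g"
    "g \<in> arrows G \<Longrightarrow> gsrc G (ginv G g) = grng G g" "g \<in> arrows G \<Longrightarrow> grng G (ginv G g) = gsrc G g"
    "g \<in> arrows G \<Longrightarrow> gcomp G g (ginv G g) = grng G g" "g \<in> arrows G \<Longrightarrow> gcomp G (ginv G g) g = gsrc G g"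
    using G by simp_all
  show "(g,h) \<in> composable G \<Longrightarrow> gcomp G g h \<in> arrows G"
    "(g,h) \<in> composable G \<Longrightarrow> gsrc G (gcomp G g h) = gsrc G h"
    "(g,h) \<in> composable G \<Longrightarrow> grng G (gcomp G g h) = grng G g" using G by auto
  show "(g,h) \<in> composable G \<Longrightarrow> (h,k) \<in> composable G \<Longrightarrow>
       gcomp G (gcomp G g h) k = gcomp G g (gcomp G h k)" using G by (elim conjE) blast
qed

lemma etale_src_chart:
  assumes "etale G" "g \<in> arrows G"
  obtains U where "openin (gtop G) U" "g \<in> U" "inj_on (gsrc G) U"
    "\<And>W. openin (gtop G) W \<Longrightarrow> W \<subseteq> U \<Longrightarrow> openin (unit_top G) (gsrc G ` W)"
proof -
  have top: "topspace (gtop G) = arrows G" using assms by (auto simp: etale_def top_groupoid_def)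
  obtain U where U: "openin (gtop G) U" "g \<in> U" "openin (unit_top G) (gsrc G ` U)"
      "homeomorphic_map (subtopology (gtop G) U) (subtopology (unit_top G) (gsrc G ` U)) (gsrc G)"
    using assms top by (auto simp: etale_def local_homeo_def)
  have sub: "U \<subseteq> topspace (gtop G)" using U(1) openin_subset by blast
  have "inj_on (gsrc G) U"
    using homeomorphic_imp_injective_map[OF U(4)] sub by (simp add: inf.absorb2)
  moreover have "openin (unit_top G) (gsrc G ` W)" if "openin (gtop G) W" "W \<subseteq> U" for W
  proof -
    have "openin (subtopology (gtop G) U) W" using that U(1) by (simp add: openin_open_subtopology)
    then have "openin (subtopology (unit_top G) (gsrc G ` U)) (gsrc G ` W)"
      using homeomorphic_imp_open_map[OF U(4)] by (simp add: open_map_def)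
    then show ?thesis using U(3) openin_trans_full by blast
  qed
  ultimately show ?thesis using that U by blast
qed

text \<open>Since \<open>g\<close> and \<open>gsrc G g\<close> have the same source, they coincide
  as soon as both lie in one chart; near a unit this is an open condition on
  \<open>g\<close>.\<close>

lemma etale_openin_units:
  assumes "etale G" shows "openin (gtop G) (units G)"
proof (subst openin_subopen, intro ballI)
  fix u assume u: "u \<in> units G"
  have G: "is_groupoid G" and cont: "continuous_map (gtop G) (gtop G) (gsrc G)"
    and top: "topspace (gtop G) = arrows G"
    using assms by (auto simp: etale_def top_groupoid_def)
  obtain U where U: "openin (gtop G) U" "u \<in> U" "inj_on (gsrc G) U"
    using etale_src_chart[OF assms is_groupoidD(4)[OF G u]] by blast
  let ?V = "U \<inter> {g \<in> topspace (gtop G). gsrc G g \<in> U}"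
  have "openin (gtop G) ?V" using U(1) cont by (blast intro: openin_continuous_map_preimage)
  moreover have "u \<in> ?V" using U u G top by (auto simp: is_groupoidD)
  moreover have "?V \<subseteq> units G"
  proof
    fix g assume g: "g \<in> ?V"
    then have "g \<in> arrows G" using top by simp
    then have "gsrc G g \<in> units G" "gsrc G (gsrc G g) = gsrc G g" using G by (simp_all add: is_groupoidD)
    moreover have "gsrc G g \<in> U" "g \<in> U" using g by auto
    ultimately show "g \<in> units G" using inj_onD[OF U(3), of "gsrc G g" g] by simp
  qed
  ultimately show "\<exists>T. openin (gtop G) T \<and> u \<in> T \<and> T \<subseteq> units G" by blast
qed

lemma continuous_map_to_unit_top:
  assumes "top_groupoid G"
  shows "continuous_map (gtop G) (unit_top G) (gsrc G)" "continuous_map (gtop G) (unit_top G) (grng G)"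
proof -
  have G: "is_groupoid G" using assms by (simp add: top_groupoid_def)
  show "continuous_map (gtop G) (unit_top G) (gsrc G)" "continuous_map (gtop G) (unit_top G) (grng G)"
    using assms is_groupoidD(1,2)[OF G] unfolding unit_top_def
    by (auto simp: continuous_map_in_subtopology top_groupoid_def)
qed

section \<open>Embeddings into the groupoid of \<open>E2\<close> from cocycles\<close>

lemma arrows_graph_groupoid [simp]: "arrows (graph_groupoid E) = gg_arrows E"
  and gsrc_graph_groupoid [simp]: "gsrc (graph_groupoid E) (x,k,y) = (y,0,y)"
  and grng_graph_groupoid [simp]: "grng (graph_groupoid E) (x,k,y) = (x,0,x)"
  and gcomp_graph_groupoid [simp]: "gcomp (graph_groupoid E) (x,k,y) (y',l,z) = (x,k+l,z)"
  and gtop_graph_groupoid: "gtop (graph_groupoid E) = topology_generated_by (gg_basic_opens E)"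
  by (auto simp: graph_groupoid_def)

lemma units_graph_groupoid: "units (graph_groupoid E) = {(x,0,x) | x. x \<in> bdry E}"
proof -
  have "(x,0,x) \<in> gg_arrows E" if "x \<in> bdry E" for x
    unfolding gg_arrows_def using that by (force intro: exI[of _ "0::nat"] simp: zero_enat_def[symmetric])
  then show ?thesis
    unfolding units_def by (force simp: gg_arrows_def image_iff)
qed

definition cocycle_map ::
  "('h,'x) groupoid_scheme \<Rightarrow> ('h \<Rightarrow> nat \<Rightarrow> bool) \<Rightarrow> ('h \<Rightarrow> int) \<Rightarrow> 'h \<Rightarrow> (unit,bool) gg_arrow" where
  "cocycle_map H \<beta> c h = (InfP (\<beta> (grng H h)), c h, InfP (\<beta> (gsrc H h)))"

lemma gg_arrows_E2:
  "(InfP x, k, InfP y) \<in> gg_arrows E2 \<longleftrightarrow>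
     (\<exists>m n. k = int m - int n \<and> (\<forall>i. x (i + m) = y (i + n)))"
  unfolding gg_arrows_def bdry_E2 by (auto simp: shift_InfP fun_eq_iff)

text \<open>The hypothesis on neighbourhoods \<open>W\<close> with a fixed pair (\<open>M\<close>,
  \<open>N\<close>) has a double role: it shows that the values are arrows, and it turns small
  images into basic open sets. The last hypothesis is faithfulness; together with continuity and
  openness it gives an embedding.\<close>

lemma etale_hom_cocycle_map:
  fixes H :: "('h,'x) groupoid_scheme"
  assumes H: "etale H" and inj: "inj_on \<beta> (units H)"
    and cont: "\<And>u n. u \<in> units H \<Longrightarrow>
      \<exists>U. openin (unit_top H) U \<and> u \<in> U \<and> (\<forall>v\<in>U. \<forall>i<n. \<beta> v i = \<beta> u i)"
    and opn: "\<And>U. openin (unit_top H) U \<Longrightarrow> seq_open (\<beta> ` U)"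
    and coc: "\<And>g h. (g,h) \<in> composable H \<Longrightarrow> c (gcomp H g h) = c g + c h"
    and loc: "\<And>h. h \<in> arrows H \<Longrightarrow> \<exists>W M N. openin (gtop H) W \<and> h \<in> W \<and>
      (\<forall>k\<in>W. c k = int M - int N \<and> (\<forall>i. \<beta> (grng H k) (i + M) = \<beta> (gsrc H k) (i + N)))"
    and ker: "\<And>h k. h \<in> arrows H \<Longrightarrow> k \<in> arrows H \<Longrightarrow> grng H h = grng H k \<Longrightarrow>
      gsrc H h = gsrc H k \<Longrightarrow> c h = c k \<Longrightarrow> h = k"
  shows "etale_hom H (graph_groupoid E2) (cocycle_map H \<beta> c)"
    and "inj_on (cocycle_map H \<beta> c) (arrows H)"
    and "\<beta> ` units H = UNIV \<Longrightarrow> cocycle_map H \<beta> c ` units H = units (graph_groupoid E2)"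
proof -
  have tg: "top_groupoid H" and G: "is_groupoid H" and top: "topspace (gtop H) = arrows H"
    using H by (auto simp: etale_def top_groupoid_def)
  let ?\<phi> = "cocycle_map H \<beta> c" and ?Y = "gtop (graph_groupoid E2)"
  note Gs = is_groupoidD[OF G]
  have arr: "?\<phi> h \<in> gg_arrows E2" if "h \<in> arrows H" for h
    using loc[OF that] unfolding cocycle_map_def gg_arrows_E2 by blast
  have hom: "groupoid_hom H (graph_groupoid E2) ?\<phi>"
    unfolding groupoid_hom_def
    using arr Gs(10,11) coc by (auto simp: cocycle_map_def) (auto simp: composable_def)
  show inj\<phi>: "inj_on ?\<phi> (arrows H)"
  proof (rule inj_onI)
    fix h k assume hk: "h \<in> arrows H" "k \<in> arrows H" "?\<phi> h = ?\<phi> k"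
    then have "grng H h = grng H k" "gsrc H h = gsrc H k"
      using inj Gs(1,2) by (auto simp: cocycle_map_def inj_on_def)
    then show "h = k" using ker hk by (auto simp: cocycle_map_def)
  qed
  have near: "\<exists>W. openin (gtop H) W \<and> h \<in> W \<and>
      (\<forall>k\<in>W. \<forall>i<n. \<beta> (grng H k) i = \<beta> (grng H h) i \<and> \<beta> (gsrc H k) i = \<beta> (gsrc H h) i)"
    if h: "h \<in> arrows H" for h n
  proof -
    obtain U where U: "openin (unit_top H) U" "grng H h \<in> U" "\<forall>v\<in>U. \<forall>i<n. \<beta> v i = \<beta> (grng H h) i"
      using cont[OF Gs(2)[OF h], of n] by blast
    obtain V where V: "openin (unit_top H) V" "gsrc H h \<in> V" "\<forall>v\<in>V. \<forall>i<n. \<beta> v i = \<beta> (gsrc H h) i"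
      using cont[OF Gs(1)[OF h], of n] by blast
    let ?W = "{k \<in> topspace (gtop H). grng H k \<in> U} \<inter> {k \<in> topspace (gtop H). gsrc H k \<in> V}"
    have "openin (gtop H) ?W"
      using openin_continuous_map_preimage continuous_map_to_unit_top[OF tg] U(1) V(1)
      by (blast intro: openin_Int)
    moreover have "h \<in> ?W" using h U V top by simp
    moreover have "\<forall>k\<in>?W. \<forall>i<n. \<beta> (grng H k) i = \<beta> (grng H h) i \<and> \<beta> (gsrc H k) i = \<beta> (gsrc H h) i"
      using U(3) V(3) by blast
    ultimately show ?thesis by blast
  qed
  have cont\<phi>: "openin (gtop H) {h \<in> topspace (gtop H). ?\<phi> h \<in> B}" if B: "B \<in> gg_basic_opens E2" for B
  proof -
    obtain U V m n where B: "B = {(x, int m - int n, y) | x y. x \<in> U \<and> y \<in> V \<and>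
         (shift E2 ^^ m) x = (shift E2 ^^ n) y}" and UV: "openin (bdry_top E2) U" "openin (bdry_top E2) V"
      using B unfolding gg_basic_opens_def by blast
    obtain U' V' where U': "U = InfP ` U'" "seq_open U'" and V': "V = InfP ` V'" "seq_open V'"
      using UV unfolding openin_bdry_E2 by blast
    have "\<exists>T. openin (gtop H) T \<and> h \<in> T \<and> T \<subseteq> {h \<in> topspace (gtop H). ?\<phi> h \<in> B}"
      if h: "h \<in> topspace (gtop H)" "?\<phi> h \<in> B" for h
    proof -
      have "InfP (\<beta> (grng H h)) \<in> U \<and> InfP (\<beta> (gsrc H h)) \<in> V \<and> c h = int m - int n \<and>
          (shift E2 ^^ m) (InfP (\<beta> (grng H h))) = (shift E2 ^^ n) (InfP (\<beta> (gsrc H h)))"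
        using h(2) unfolding cocycle_map_def B by blast
      then have hB: "\<beta> (grng H h) \<in> U'" "\<beta> (gsrc H h) \<in> V'" "c h = int m - int n"
        "\<And>i. \<beta> (grng H h) (i + m) = \<beta> (gsrc H h) (i + n)"
        unfolding shift_InfP U'(1) V'(1) bpath.inject by (blast dest: fun_cong)+
      obtain p where p: "\<forall>y. (\<forall>i<p. y i = \<beta> (grng H h) i) \<longrightarrow> y \<in> U'"
        using U'(2) hB(1) unfolding seq_open_def by blast
      obtain q where q: "\<forall>y. (\<forall>i<q. y i = \<beta> (gsrc H h) i) \<longrightarrow> y \<in> V'"
        using V'(2) hB(2) unfolding seq_open_def by blast
      obtain W M N where W: "openin (gtop H) W" "h \<in> W"
        "\<And>k. k \<in> W \<Longrightarrow> c k = int M - int N"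
        "\<And>k i. k \<in> W \<Longrightarrow> \<beta> (grng H k) (i + M) = \<beta> (gsrc H k) (i + N)"
        using loc h(1) top by metis
      obtain W' where W': "openin (gtop H) W'" "h \<in> W'"
        "\<And>k i. k \<in> W' \<Longrightarrow> i < p + q + M + N \<Longrightarrow> \<beta> (grng H k) i = \<beta> (grng H h) i"
        "\<And>k i. k \<in> W' \<Longrightarrow> i < p + q + M + N \<Longrightarrow> \<beta> (gsrc H k) i = \<beta> (gsrc H h) i"
        using near[of h "p + q + M + N"] h(1) top by metis
      have MN: "int M - int N = int m - int n" using W(3)[OF W(2)] hB(3) by simp
      have "?\<phi> k \<in> B" if k: "k \<in> W \<inter> W'" for k
      proof -
        have "\<beta> (grng H k) \<in> U'" "\<beta> (gsrc H k) \<in> V'" using p q W'(3,4)[of k] k by auto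
        \<comment> \<open>The pairs (\<open>M\<close>, \<open>N\<close>) and (\<open>m\<close>,
          \<open>n\<close>) have the same difference, but \<open>M\<close> may be larger. Then the
          equations below \<open>M\<close> are inherited from \<open>h\<close>, because
          \<open>W'\<close> freezes these letters; the others come from the pair (\<open>M\<close>,
          \<open>N\<close>).\<close>
        moreover have "\<beta> (grng H k) (i + m) = \<beta> (gsrc H k) (i + n)" for i
        proof (cases "i + m < M")
          case True
          then have "i + n < N" using MN by linarith
          then show ?thesis using True W'(3)[of k "i + m"] W'(4)[of k "i + n"] hB(4)[of i] k by simp
        next
          case False
          then have "i + m = (i + m - M) + M" "i + n = (i + m - M) + N" using MN by linarith+
          then show ?thesis using W(4)[of k "i + m - M"] k by simp
        qed
        moreover have "c k = int m - int n" using W(3) k MN by simp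
        ultimately show ?thesis by (simp add: B U'(1) V'(1) cocycle_map_def shift_InfP)
      qed
      moreover have "W \<inter> W' \<subseteq> topspace (gtop H)" using W(1) openin_subset by blast
      ultimately show ?thesis using W(1,2) W'(1,2) by (intro exI[of _ "W \<inter> W'"]) blast
    qed
    then show ?thesis by (subst openin_subopen) blast
  qed
  have opn\<phi>: "\<exists>T. openin ?Y T \<and> ?\<phi> h \<in> T \<and> T \<subseteq> ?\<phi> ` W0"
    if W0: "openin (gtop H) W0" "h \<in> W0" for h W0
  proof -
    have h: "h \<in> arrows H" using W0 openin_subset top by blast
    obtain W M N where W: "openin (gtop H) W" "h \<in> W"
        "\<And>k. k \<in> W \<Longrightarrow> c k = int M - int N"
        "\<And>k i. k \<in> W \<Longrightarrow> \<beta> (grng H k) (i + M) = \<beta> (gsrc H k) (i + N)"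
      using loc h by metis
    obtain W' where W': "openin (gtop H) W'" "h \<in> W'"
        "\<And>k i. k \<in> W' \<Longrightarrow> i < M + N \<Longrightarrow> \<beta> (grng H k) i = \<beta> (grng H h) i"
        "\<And>k i. k \<in> W' \<Longrightarrow> i < M + N \<Longrightarrow> \<beta> (gsrc H k) i = \<beta> (gsrc H h) i"
      using near[of h "M + N"] h by metis
    obtain C where C: "openin (gtop H) C" "h \<in> C"
        "\<And>W. openin (gtop H) W \<Longrightarrow> W \<subseteq> C \<Longrightarrow> openin (unit_top H) (gsrc H ` W)"
      by (rule etale_src_chart[OF H h]) (rule that)
    define D where "D = W0 \<inter> W \<inter> W' \<inter> C"
    have D: "openin (gtop H) D" "h \<in> D" using W0 W W' C by (auto simp: D_def)
    define V where "V = \<beta> ` gsrc H ` D"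
    \<comment> \<open>U equals the image of D under the coded range map, but this form is visibly open.\<close>
    define U where "U = {x. (\<forall>i<M. x i = \<beta> (grng H h) i) \<and> (\<exists>y\<in>V. \<forall>i. x (i + M) = y (i + N))}"
    have oV: "seq_open V"
      unfolding V_def by (rule opn, rule C(3)[OF D(1)]) (auto simp: D_def)
    have oU: "seq_open U"
      unfolding seq_open_def
    proof
      fix x assume "x \<in> U"
      then obtain y where x: "\<forall>i<M. x i = \<beta> (grng H h) i" and y: "y \<in> V" "\<And>i. x (i + M) = y (i + N)"
        by (auto simp: U_def)
      obtain n where n: "\<And>z. (\<forall>i<n. z i = y i) \<Longrightarrow> z \<in> V" using oV y(1) unfolding seq_open_def by blast
      have "x' \<in> U" if x': "\<forall>i<n + M. x' i = x i" for x'
      proof -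
        \<comment> \<open>Exchange the first \<open>M\<close> letters of \<open>x'\<close> for the
          first \<open>N\<close> letters of \<open>y\<close>.\<close>
        let ?z = "\<lambda>i. if i < N then y i else x' (i - N + M)"
        have "?z i = y i" if i: "i < n" for i
        proof (cases "i < N")
          case False
          have "x' (i - N + M) = x (i - N + M)" using i by (intro x'[rule_format]) linarith
          then show ?thesis using y(2)[of "i - N"] False by simp
        qed simp
        then have "?z \<in> V" by (intro n) blast
        moreover have "\<forall>i. x' (i + M) = ?z (i + N)" by simp
        moreover have "\<forall>i<M. x' i = \<beta> (grng H h) i" using x x' by simp
        ultimately show ?thesis unfolding U_def mem_Collect_eq by (intro conjI bexI[of _ ?z])
      qed
      then show "\<exists>n. \<forall>y. (\<forall>i<n. y i = x i) \<longrightarrow> y \<in> U" by blast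
    qed
    \<comment> \<open>The first \<open>N\<close> letters are constant on \<open>V\<close>, so
      deleting them is injective there.\<close>
    have Vpre: "y i = \<beta> (gsrc H h) i" if "y \<in> V" "i < N" for y i
      using that W'(4) by (auto simp: V_def D_def)
    let ?B = "{(x, int M - int N, y) | x y. x \<in> InfP ` U \<and> y \<in> InfP ` V \<and>
         (shift E2 ^^ M) x = (shift E2 ^^ N) y}"
    have "?B \<in> gg_basic_opens E2"
      unfolding gg_basic_opens_def mem_Collect_eq
    proof (intro exI conjI)
      show "?B = ?B" ..
      show "openin (bdry_top E2) (InfP ` U)" "openin (bdry_top E2) (InfP ` V)"
        using oU oV unfolding openin_bdry_E2 by blast+
      show "\<forall>x\<in>InfP ` U. enat M \<le> plen x" "\<forall>x\<in>InfP ` V. enat N \<le> plen x" by auto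
      show "inj_on (shift E2 ^^ M) (InfP ` U)"
      proof (rule inj_onI, clarsimp simp: shift_InfP)
        fix x x' assume "x \<in> U" "x' \<in> U" and eq: "(\<lambda>i. x (i + M)) = (\<lambda>i. x' (i + M))"
        then have "x i = x' i" for i
          using fun_cong[OF eq, of "i - M"] by (cases "i < M") (auto simp: U_def)
        then show "x = x'" ..
      qed
      show "inj_on (shift E2 ^^ N) (InfP ` V)"
      proof (rule inj_onI, clarsimp simp: shift_InfP)
        fix x x' assume xV: "x \<in> V" "x' \<in> V" and eq: "(\<lambda>i. x (i + N)) = (\<lambda>i. x' (i + N))"
        have "x i = x' i" for i
          using fun_cong[OF eq, of "i - N"] Vpre[OF xV(1), of i] Vpre[OF xV(2), of i]
          by (cases "i < N") auto
        then show "x = x'" ..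
      qed
      show "(shift E2 ^^ M) ` InfP ` U = (shift E2 ^^ N) ` InfP ` V"
      proof (intro equalityI subsetI)
        fix z assume "z \<in> (shift E2 ^^ M) ` InfP ` U"
        then show "z \<in> (shift E2 ^^ N) ` InfP ` V"
          by (auto simp: U_def shift_InfP image_iff)
      next
        fix z assume "z \<in> (shift E2 ^^ N) ` InfP ` V"
        then obtain y where y: "y \<in> V" "z = InfP (\<lambda>i. y (i + N))" by (auto simp: shift_InfP)
        let ?x = "\<lambda>i. if i < M then \<beta> (grng H h) i else y (i - M + N)"
        have "?x \<in> U" unfolding U_def using y(1) by auto
        moreover have "z = (shift E2 ^^ M) (InfP ?x)" using y(2) by (simp add: shift_InfP)
        ultimately show "z \<in> (shift E2 ^^ M) ` InfP ` U" by blast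
      qed
    qed
    then have "openin ?Y ?B"
      unfolding gtop_graph_groupoid by (rule topology_generated_by_Basis)
    moreover have inU: "\<beta> (grng H k) \<in> U" if "k \<in> D" for k
      unfolding U_def V_def using that W(4) W'(3) by (auto simp: D_def)
    then have "?\<phi> h \<in> ?B"
      using D(2) W(3,4)[OF W(2)] by (auto simp: cocycle_map_def shift_InfP V_def)
    moreover have "?B \<subseteq> ?\<phi> ` W0"
    proof clarsimp
      fix x y assume x: "x \<in> U" and y: "y \<in> V"
        and xy: "(shift E2 ^^ M) (InfP x) = (shift E2 ^^ N) (InfP y)"
      obtain k where k: "k \<in> D" "y = \<beta> (gsrc H k)" using y by (auto simp: V_def)
      have "x i = \<beta> (grng H k) i" for i
      proof (cases "i < M")
        case True
        then show ?thesis using x inU[OF k(1)] by (simp add: U_def)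
      next
        case False
        have "(\<lambda>i. x (i + M)) = (\<lambda>i. y (i + N))" using xy by (simp add: shift_InfP)
        from fun_cong[OF this, of "i - M"] have "x i = y (i - M + N)" using False by simp
        then show ?thesis using W(4)[of k "i - M"] k False by (simp add: D_def)
      qed
      then have "x = \<beta> (grng H k)" ..
      then have "(InfP x, int M - int N, InfP y) = ?\<phi> k"
        using k W(3) by (simp add: cocycle_map_def D_def)
      then show "(InfP x, int M - int N, InfP y) \<in> ?\<phi> ` W0" using k(1) by (auto simp: D_def)
    qed
    ultimately show ?thesis by blast
  qed
  have om: "open_map (gtop H) ?Y ?\<phi>"
    unfolding open_map_def
  proof (intro allI impI)
    fix W assume "openin (gtop H) W"
    then show "openin ?Y (?\<phi> ` W)"
      using opn\<phi> by (subst openin_subopen) blast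
  qed
  have sub: "?\<phi> ` topspace (gtop H) \<subseteq> topspace ?Y"
    using om openin_topspace openin_subset unfolding open_map_def by blast
  have cm: "continuous_map (gtop H) ?Y ?\<phi>"
    unfolding gtop_graph_groupoid
  proof (rule continuous_on_generated_topo)
    show "openin (gtop H) (?\<phi> -` U \<inter> topspace (gtop H))" if "U \<in> gg_basic_opens E2" for U
      using cont\<phi>[OF that] by (simp add: vimage_def Int_def conj_commute)
    show "?\<phi> ` topspace (gtop H) \<subseteq> \<Union> (gg_basic_opens E2)"
      using sub unfolding gtop_graph_groupoid topology_generated_by_topspace .
  qed
  have "embedding_map (gtop H) ?Y ?\<phi>"
    using injective_open_imp_embedding_map[OF cm om] inj\<phi> top by simp
  then have hm: "homeomorphic_map (gtop H) (subtopology ?Y (?\<phi> ` topspace (gtop H))) ?\<phi>"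
    by (simp add: embedding_map_def)
  \<comment> \<open>The map is an open embedding, so the whole arrow space is a chart at every
    point.\<close>
  have "local_homeo (gtop H) ?Y ?\<phi>"
    unfolding local_homeo_def
  proof (intro conjI ballI sub exI)
    show "openin (gtop H) (topspace (gtop H))" by simp
    show "openin ?Y (?\<phi> ` topspace (gtop H))" using om unfolding open_map_def by blast
  qed (use hm in simp_all)
  then show "etale_hom H (graph_groupoid E2) ?\<phi>" using hom by (simp add: etale_hom_def)
  have c0: "c u = 0" if "u \<in> units H" for u
  proof -
    have "(u,u) \<in> composable H" "gcomp H u u = u" using that Gs(4-7) by (auto simp: composable_def) metis
    then show ?thesis using coc[of u u] by simp
  qed
  show "?\<phi> ` units H = units (graph_groupoid E2)" if "\<beta> ` units H = UNIV"
  proof -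
    have "?\<phi> ` units H = (\<lambda>x. (InfP x, 0, InfP x)) ` \<beta> ` units H"
      using c0 Gs(5,6) by (auto simp: cocycle_map_def image_image intro!: image_cong)
    then show ?thesis unfolding that by (auto simp: units_graph_groupoid bdry_E2)
  qed
qed

section \<open>Coding boundary paths by binary sequences\<close>

text \<open>Each vertex has its own code, so edges at different vertices may share words; a sequence
  determines a path only once the source vertex is known.\<close>

definition alpha :: "('v,'e) graph \<Rightarrow> 'e \<Rightarrow> bool list" where
  "alpha E e = code (emits E (gsource E e)) e"

definition acode :: "('v,'e) graph \<Rightarrow> 'e list \<Rightarrow> bool list" where
  "acode E es = concat (map (alpha E) es)"

fun psource :: "('v,'e) graph \<Rightarrow> ('v,'e) bpath \<Rightarrow> 'v" where
  "psource E (FinP v es) = v"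
| "psource E (InfP f) = gsource E (f 0)"

text \<open>Uniform access to the edges of finite and infinite paths. Past the end of a finite path
  the value is meaningless, whence the guards \<open>enat m \<le> plen x\<close> on initial
  segments.\<close>

fun pedge :: "('v,'e) bpath \<Rightarrow> nat \<Rightarrow> 'e" where
  "pedge (FinP v es) i = es ! i"
| "pedge (InfP f) i = f i"

definition ptake :: "('v,'e) bpath \<Rightarrow> nat \<Rightarrow> 'e list" where
  "ptake x m = map (pedge x) [0..<m]"

definition alen :: "('v,'e) graph \<Rightarrow> ('v,'e) bpath \<Rightarrow> nat \<Rightarrow> nat" where
  "alen E x m = length (acode E (ptake x m))"

text \<open>The value is True past the end of the word of a finite path, which is the limit of the words of
  its one-edge extensions when its range is an infinite emitter.\<close>
definition psi :: "('v,'e) graph \<Rightarrow> ('v,'e) bpath \<Rightarrow> nat \<Rightarrow> bool" where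
  "psi E x k = (\<forall>m. enat m \<le> plen x \<longrightarrow> k < alen E x m \<longrightarrow> acode E (ptake x m) ! k)"

lemma acode_append [simp]: "acode E (es @ ds) = acode E es @ acode E ds"
  and acode_Nil [simp]: "acode E [] = []"
  and acode_single [simp]: "acode E [e] = alpha E e"
  by (simp_all add: acode_def)

lemma length_ptake [simp]: "length (ptake x m) = m"
  and ptake_0 [simp]: "ptake x 0 = []"
  and ptake_Suc: "ptake x (Suc m) = ptake x m @ [pedge x m]"
  by (simp_all add: ptake_def)

lemma ptake_FinP: "ptake (FinP v es) (length es) = es"
  by (intro nth_equalityI) (auto simp: ptake_def)

lemma shift_FinP:
  "m \<le> length es \<Longrightarrow> (shift E ^^ m) (FinP v es) = FinP (prange E v (take m es)) (drop m es)"
proof (induction m)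
  case (Suc m)
  then have "drop m es = es ! m # drop (Suc m) es" "take (Suc m) es = take m es @ [es ! m]"
    by (simp_all add: Cons_nth_drop_Suc take_Suc_conv_app_nth)
  then show ?case using Suc by (simp add: prange_def)
qed (simp add: prange_def)

lemma plen_shift: "enat m \<le> plen x \<Longrightarrow> plen ((shift E ^^ m) x) = plen x - enat m"
  by (cases x) (auto simp: shift_FinP shift_InfP)

lemma pedge_shift: "enat (m + i) < plen x \<Longrightarrow> pedge ((shift E ^^ m) x) i = pedge x (m + i)"
  by (cases x) (auto simp: shift_FinP shift_InfP add.commute)

lemma ptake_add:
  assumes "enat (m + d) \<le> plen x"
  shows "ptake x (m + d) = ptake x m @ ptake ((shift E ^^ m) x) d"
  using assms
proof (induction d)
  case (Suc d)
  have "enat (m + d) < plen x" using Suc.prems by (cases x) auto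
  then show ?case using Suc.IH pedge_shift[of m d x E] by (simp add: ptake_Suc)
qed simp

lemma alen_add:
  assumes "enat (m + d) \<le> plen x"
  shows "alen E x (m + d) = alen E x m + alen E ((shift E ^^ m) x) d"
  using ptake_add[OF assms, of E] by (simp add: alen_def)

text \<open>The words of the initial segments are nested, so the universal quantifier in
  \<open>psi\<close> always reads the same letter.\<close>

lemma acode_ptake_nth:
  assumes "enat m \<le> plen x" "enat n \<le> plen x" "k < alen E x m" "k < alen E x n"
  shows "acode E (ptake x m) ! k = acode E (ptake x n) ! k"
proof -
  have *: "acode E (ptake x m) ! k = acode E (ptake x n) ! k"
    if "enat n \<le> plen x" "k < alen E x m" "m \<le> n" for m n
    using ptake_add[of m "n - m" x E] that by (simp add: nth_append alen_def)
  show ?thesis using *[of n m] *[of m n] assms by (metis nat_le_linear)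
qed

lemma word_prefix_psi: "enat m \<le> plen x \<Longrightarrow> word_prefix (acode E (ptake x m)) (psi E x)"
  unfolding word_prefix_def psi_def alen_def[symmetric] using acode_ptake_nth by blast

lemma psi_default: "(\<And>m. enat m \<le> plen x \<Longrightarrow> alen E x m \<le> k) \<Longrightarrow> psi E x k"
  by (meson linorder_not_less psi_def)

text \<open>The word of the first \<open>m + d\<close> edges is that of the first \<open>m\<close>
  followed by that of the next \<open>d\<close>. This is the rule by which lags change under the
  coding.\<close>

lemma psi_shift:
  assumes "enat m \<le> plen x"
  shows "psi E ((shift E ^^ m) x) k = psi E x (k + alen E x m)"
proof -
  have A: "enat (m + d) \<le> plen x \<longleftrightarrow> enat d \<le> plen ((shift E ^^ m) x)" for d
    using assms by (cases x) (auto simp: shift_FinP shift_InfP)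
  have eq: "k < alen E ((shift E ^^ m) x) d \<longleftrightarrow> k + alen E x m < alen E x (m + d)"
    "acode E (ptake ((shift E ^^ m) x) d) ! k = acode E (ptake x (m + d)) ! (k + alen E x m)"
    if "enat (m + d) \<le> plen x" for d
    using ptake_add[OF that, of E] by (auto simp: alen_def nth_append)
  show ?thesis
  proof
    assume L: "psi E ((shift E ^^ m) x) k"
    show "psi E x (k + alen E x m)"
      unfolding psi_def
    proof (intro allI impI)
      fix n assume n: "enat n \<le> plen x" "k + alen E x m < alen E x n"
      have "m \<le> n"
      proof (rule ccontr)
        assume "\<not> m \<le> n"
        then show False using alen_add[of n "m - n" x E] assms n(2) by simp
      qed
      then show "acode E (ptake x n) ! (k + alen E x m)"
        using L[unfolded psi_def, rule_format, of "n - m"] n A[of "n - m"] eq[of "n - m"] by simp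
    qed
  next
    assume R: "psi E x (k + alen E x m)"
    show "psi E ((shift E ^^ m) x) k"
      unfolding psi_def
    proof (intro allI impI)
      fix d assume d: "enat d \<le> plen ((shift E ^^ m) x)" "k < alen E ((shift E ^^ m) x) d"
      show "acode E (ptake ((shift E ^^ m) x) d) ! k"
        using R[unfolded psi_def, rule_format, of "m + d"] d A[of d] eq[of d] by simp
    qed
  qed
qed

lemma is_pref_iff:
  fixes E :: "('v,'e) graph"
  shows "is_pref E v es x \<longleftrightarrow> psource E x = v \<and> enat (length es) \<le> plen x \<and> ptake x (length es) = es"
proof (cases x)
  case (FinP w ds)
  have tk: "ptake (FinP w ds :: ('v,'e) bpath) n = take n ds" if "n \<le> length ds" for n
    using that by (intro nth_equalityI) (auto simp: ptake_def)
  show ?thesis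
  proof (cases "length es \<le> length ds")
    case True
    then show ?thesis using tk[OF True] by (simp add: FinP)
  next
    case False
    then show ?thesis by (auto simp: FinP)
  qed
next
  case (InfP f)
  have "ptake (InfP f :: ('v,'e) bpath) (length es) = es \<longleftrightarrow> (\<forall>i<length es. f i = es ! i)"
  proof
    have nth: "ptake (InfP f :: ('v,'e) bpath) (length es) ! i = f i" if "i < length es" for i
      using that by (simp add: ptake_def)
    show "\<forall>i<length es. f i = es ! i" if "ptake (InfP f :: ('v,'e) bpath) (length es) = es"
      using nth that by simp
    show "ptake (InfP f :: ('v,'e) bpath) (length es) = es" if "\<forall>i<length es. f i = es ! i"
      by (rule nth_equalityI) (use nth that in simp_all)
  qed
  then show ?thesis unfolding InfP by simp
qed

lemma fin_path_Nil [simp]: "fin_path E v [] \<longleftrightarrow> v \<in> verts E"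
  by (simp add: fin_path_def)

lemma fin_path_snoc:
  "fin_path E v (es @ [e]) \<longleftrightarrow> fin_path E v es \<and> e \<in> edges E \<and> gsource E e = prange E v es"
proof (cases "es = []")
  case False
  have "(\<forall>i. Suc i < length (es @ [e]) \<longrightarrow> grange E ((es @ [e]) ! i) = gsource E ((es @ [e]) ! Suc i)) \<longleftrightarrow>
    (\<forall>i. Suc i < length es \<longrightarrow> grange E (es ! i) = gsource E (es ! Suc i)) \<and> grange E (last es) = gsource E e"
    (is "(\<forall>i. ?P i) \<longleftrightarrow> _")
  proof (intro iffI conjI allI impI; (elim conjE)?)
    fix i assume "\<forall>i. ?P i" and "Suc i < length es"
    then show "grange E (es ! i) = gsource E (es ! Suc i)"
      using spec[of ?P i] by (simp add: nth_append)
  next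
    assume "\<forall>i. ?P i"
    then show "grange E (last es) = gsource E e"
      using spec[of ?P "length es - 1"] False by (simp add: nth_append last_conv_nth)
  next
    fix i assume *: "\<forall>i. Suc i < length es \<longrightarrow> grange E (es ! i) = gsource E (es ! Suc i)"
      "grange E (last es) = gsource E e" "Suc i < length (es @ [e])"
    then consider "Suc i < length es" | "Suc i = length es" by fastforce
    then show "grange E ((es @ [e]) ! i) = gsource E ((es @ [e]) ! Suc i)"
    proof cases
      case 2
      then have "i = length es - 1" by simp
      then show ?thesis using * 2 False by (simp add: nth_append last_conv_nth)
    qed (use * in \<open>simp add: nth_append\<close>)
  qed
  then show ?thesis using False by (auto simp: fin_path_def prange_def)
qed (auto simp: fin_path_def prange_def)

lemma fin_path_ptake:
  assumes "countable_graph E" "x \<in> bdry E" "enat n \<le> plen x"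
  shows "fin_path E (psource E x) (ptake x n)"
proof (cases x)
  case (FinP v es)
  then have "fin_path E v es" using assms by (auto simp: bdry_def)
  moreover have "ptake x n = take n es"
    unfolding FinP using assms(3) FinP by (intro nth_equalityI) (auto simp: ptake_def)
  ultimately show ?thesis unfolding FinP
    by (auto simp: fin_path_def hd_take dest: in_set_takeD)
next
  case (InfP f)
  then have f: "\<And>i. f i \<in> edges E" "\<And>i. grange E (f i) = gsource E (f (Suc i))"
    using assms by (auto simp: bdry_def inf_path_def)
  then have "gsource E (f 0) \<in> verts E" using assms(1) by (auto simp: countable_graph_def)
  then show ?thesis using f unfolding InfP by (auto simp: fin_path_def ptake_def hd_map)
qed

lemma next_edge:
  assumes "countable_graph E" "x \<in> bdry E" "enat n < plen x"
  shows "pedge x n \<in> emits E (prange E (psource E x) (ptake x n))"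
proof -
  have "enat (Suc n) \<le> plen x" using assms(3) by (cases x) auto
  then show ?thesis
    using fin_path_ptake[OF assms(1,2), of "Suc n"] by (auto simp: ptake_Suc fin_path_snoc emits_def)
qed

lemma psource_in_verts: "countable_graph E \<Longrightarrow> x \<in> bdry E \<Longrightarrow> psource E x \<in> verts E"
  using fin_path_ptake[of E x 0] by (simp add: zero_enat_def[symmetric])

lemma enat_eqI:
  assumes "\<And>n. enat n \<le> a \<longleftrightarrow> enat n \<le> b"
  shows "a = b"
proof (cases a; cases b)
  fix m n assume "a = enat m" "b = enat n"
  then show ?thesis using assms[of m] assms[of n] by simp
next
  fix m assume "a = enat m" "b = \<infinity>"
  then show ?thesis using assms[of "Suc m"] by simp
next
  fix n assume "a = \<infinity>" "b = enat n"
  then show ?thesis using assms[of "Suc n"] by simp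
qed simp

lemma bpath_eqI:
  assumes "psource E x = psource E y" "plen x = plen y"
    "\<And>n. enat n \<le> plen x \<Longrightarrow> ptake x n = ptake y n"
  shows "x = y"
proof (cases x)
  case (FinP v es)
  then obtain ds where "y = FinP v ds" "length ds = length es" using assms by (cases y) auto
  then show ?thesis using assms(3)[of "length es"] FinP ptake_FinP[of v es] ptake_FinP[of v ds] by simp
next
  case (InfP f)
  then obtain g where g: "y = InfP g" using assms by (cases y) auto
  have "f n = g n" for n using assms(3)[of "Suc n"] InfP g by (simp add: ptake_Suc)
  then show ?thesis using InfP g by auto
qed

lemma inf_path_tail: "inf_path E f \<Longrightarrow> inf_path E (\<lambda>i. f (i + m))"
  by (auto simp: inf_path_def)

lemma countable_emits: "countable_graph E \<Longrightarrow> countable (emits E v)"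
  by (auto simp: countable_graph_def emits_def intro: countable_subset[of _ "edges E"])

section \<open>Growth of the words along infinite paths\<close>

text \<open>If all words were empty, every vertex on the path would emit just the next edge.
  Visiting each vertex finitely often, the path would be a semi-tail; a vertex visited twice would
  close a cycle without exit.\<close>

lemma ex_nonempty_code:
  assumes "countable_graph E" "condition_L E" "no_semi_tails E" "inf_path E f"
  shows "\<exists>i. alpha E (f i) \<noteq> []"
proof (rule ccontr)
  assume *: "\<nexists>i. alpha E (f i) \<noteq> []"
  have f: "\<And>i. f i \<in> edges E" "\<And>i. grange E (f i) = gsource E (f (Suc i))"
    using assms(4) by (auto simp: inf_path_def)
  have single: "emits E (gsource E (f i)) = {f i}" for i
    using code_eq_Nil[OF countable_emits[OF assms(1)], of "f i"] * f by (auto simp: alpha_def emits_def)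
  then have "\<not> wandering E f" using assms(3) by (auto simp: no_semi_tails_def semi_tail_def)
  then obtain v where v: "infinite {i. gsource E (f i) = v}" using assms(4) by (auto simp: wandering_def)
  then obtain i where i: "gsource E (f i) = v" using not_finite_existsD by blast
  obtain j where j: "i < j" "gsource E (f j) = v"
    using v unfolding infinite_nat_iff_unbounded by blast
  let ?es = "map f [i..<j]"
  have "fin_path E v ?es"
    using i j f assms(1) by (auto simp: fin_path_def hd_map countable_graph_def)
  moreover have "prange E v ?es = v"
  proof -
    obtain k where "j = Suc k" "i \<le> k" using j(1) by (cases j) auto
    then show ?thesis using f(2)[of k] j(2) by (simp add: prange_def)
  qed
  ultimately obtain k e where "k < length ?es" "e \<in> edges E" "e \<noteq> ?es ! k" "gsource E e = gsource E (?es ! k)"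
    using assms(2) j(1) unfolding condition_L_def by (metis list.map_disc_iff upt_eq_Nil_conv not_less le_zero_eq gr_implies_not0)
  then show False using single[of "i + k"] by (auto simp: emits_def)
qed

text \<open>Every tail again contains a nonempty word. Infinite paths therefore spell out complete
  sequences and never use the default value of \<open>psi\<close>.\<close>

lemma alen_unbounded:
  assumes "countable_graph E" "condition_L E" "no_semi_tails E" "inf_path E f"
  shows "\<exists>m. k \<le> alen E (InfP f) m"
proof (induction k)
  case (Suc k)
  then obtain m where m: "k \<le> alen E (InfP f) m" by blast
  obtain i where i: "alpha E (f (i + m)) \<noteq> []"
    using ex_nonempty_code[OF assms(1-3) inf_path_tail[OF assms(4), of m]] by blast
  have "alen E (InfP f) m + alen E (InfP (\<lambda>j. f (j + m))) (Suc i) = alen E (InfP f) (m + Suc i)"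
    using alen_add[of m "Suc i" "InfP f" E] by (simp add: shift_InfP)
  moreover have "alen E (InfP (\<lambda>j. f (j + m))) (Suc i) > 0"
    using i by (simp add: alen_def ptake_Suc)
  ultimately show ?case using m by (intro exI[of _ "m + Suc i"]) linarith
qed simp

section \<open>The coding as a homeomorphism on the paths from one vertex\<close>

locale coded_graph =
  fixes E :: "('v,'e) graph"
  assumes cg: "countable_graph E" and cL: "condition_L E" and ns: "no_sinks E" and nst: "no_semi_tails E"
begin

text \<open>The path is decoded edge by edge. While it continues, prefix-freeness identifies the
  next edge; once it has stopped at an infinite emitter, its remaining letters are all 1, whereas
  every edge word there contains a 0.\<close>

lemma is_pref_iff_word_prefix:
  assumes x: "x \<in> bdry E" and es: "fin_path E (psource E x) es"
  shows "is_pref E (psource E x) es x \<longleftrightarrow> word_prefix (acode E es) (psi E x)"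
proof
  assume "is_pref E (psource E x) es x"
  then show "word_prefix (acode E es) (psi E x)" using word_prefix_psi[of "length es" x E] by (auto simp: is_pref_iff)
next
  assume "word_prefix (acode E es) (psi E x)"
  then show "is_pref E (psource E x) es x"
    using es
  proof (induction es rule: rev_induct)
    case Nil
    then show ?case by (simp add: is_pref_iff zero_enat_def[symmetric])
  next
    case (snoc e es)
    let ?n = "length es" and ?S = "emits E (prange E (psource E x) es)"
    have fp: "fin_path E (psource E x) es" and e: "e \<in> ?S" and se: "gsource E e = prange E (psource E x) es"
      using snoc.prems(2) by (auto simp: fin_path_snoc emits_def)
    have w: "word_prefix (acode E es) (psi E x)" "word_prefix (alpha E e) (\<lambda>i. psi E x (i + length (acode E es)))"
      using snoc.prems(1) by (auto simp: word_prefix_append)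
    have pre: "enat ?n \<le> plen x" "ptake x ?n = es" using snoc.IH[OF w(1) fp] by (auto simp: is_pref_iff)
    show ?case
    proof (cases "enat ?n < plen x")
      case True
      then have le: "enat (Suc ?n) \<le> plen x" by (cases x) auto
      have d: "pedge x ?n \<in> ?S" using next_edge[OF cg x True] pre(2) by simp
      have "word_prefix (alpha E (pedge x ?n)) (\<lambda>i. psi E x (i + length (acode E es)))"
        using word_prefix_psi[OF le, of E] pre(2) by (simp add: ptake_Suc word_prefix_append)
      then have "e = pedge x ?n"
        using code_inj[OF countable_emits[OF cg] e d] w(2) se d by (auto simp: alpha_def emits_def)
      then show ?thesis using pre le by (simp add: is_pref_iff ptake_Suc)
    next
      case False
      then obtain v ds where ds: "x = FinP v ds" "length ds = length es"
        using pre by (cases x) auto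
      then have v: "x = FinP v es" using pre(2) ptake_FinP[of v ds] by simp
      \<comment> \<open>The last vertex emits \<open>e\<close>, so being singular it must be an
        infinite emitter.\<close>
      have "infinite ?S"
        using x ns e unfolding v by (auto simp: bdry_def singular_def)
      moreover have "psi E x (i + length (acode E es))" for i
      proof (rule psi_default)
        fix m assume "enat m \<le> plen x"
        then have "alen E x m \<le> alen E x ?n" using alen_add[of m "?n - m" x E] v by simp
        then show "alen E x m \<le> i + length (acode E es)" using pre(2) by (simp add: alen_def)
      qed
      ultimately show ?thesis using code_infinite_has_False w(2) se by (fastforce simp: alpha_def)
    qed
  qed
qed

lemma psi_inj:
  assumes "x \<in> bdry E" "y \<in> bdry E" "psource E x = psource E y" "psi E x = psi E y"
  shows "x = y"
proof -
  have *: "enat n \<le> plen y \<and> ptake y n = ptake x n"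
    if "x \<in> bdry E" "y \<in> bdry E" "psource E x = psource E y" "psi E x = psi E y" "enat n \<le> plen x" for x y n
    using is_pref_iff_word_prefix[of y "ptake x n"] fin_path_ptake[OF cg, of x n] word_prefix_psi[of n x E] that
    by (simp add: is_pref_iff)
  show ?thesis
  proof (rule bpath_eqI[OF assms(3)])
    have "enat n \<le> plen x \<longleftrightarrow> enat n \<le> plen y" for n using *[of x y n] *[of y x n] assms by auto
    then show "plen x = plen y" by (intro enat_eqI)
    show "\<And>n. enat n \<le> plen x \<Longrightarrow> ptake x n = ptake y n" using *[of x y] assms by auto
  qed
qed

text \<open>Decode \<open>w\<close> greedily. If some decoded path cannot be extended, completeness
  of the codes forces its range to be an infinite emitter and the remaining letters of
  \<open>w\<close> to be 1, which is the coding of that finite path. Otherwise the extensions form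
  an infinite path, whose words exhaust \<open>w\<close> because their lengths are
  unbounded.\<close>

lemma psi_surj:
  assumes v: "v \<in> verts E"
  shows "\<exists>x\<in>bdry E. psource E x = v \<and> psi E x = w"
proof -
  define P where "P es \<longleftrightarrow> fin_path E v es \<and> word_prefix (acode E es) w" for es
  show ?thesis
  proof (cases "\<exists>es. P es \<and> (\<forall>e. \<not> P (es @ [e]))")
    case True
    then obtain es where es: "P es" "\<And>e. \<not> P (es @ [e])" by blast
    let ?S = "emits E (prange E v es)" and ?x = "FinP v es :: ('v,'e) bpath" and ?L = "length (acode E es)"
    have "prange E v es \<in> verts E"
      using es(1) cg v unfolding P_def prange_def countable_graph_def fin_path_def
      by (auto simp: subset_iff)
    then have "?S \<noteq> {}" using ns by (auto simp: no_sinks_def)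
    moreover have "\<not> word_prefix (code ?S e) (\<lambda>i. w (i + ?L))" if "e \<in> ?S" for e
      using es that by (auto simp: P_def fin_path_snoc word_prefix_append alpha_def emits_def)
    ultimately have S: "infinite ?S" "\<And>i. w (i + ?L)"
      using code_total[OF countable_emits[OF cg], of "prange E v es" "\<lambda>i. w (i + ?L)"] by blast+
    have x: "?x \<in> bdry E" using es(1) S by (auto simp: bdry_def singular_def P_def)
    have "psi E ?x k = w k" for k
    proof (cases "k < ?L")
      case True
      then show ?thesis using word_prefix_psi[of "length es" ?x E] es(1) by (simp add: ptake_FinP P_def word_prefix_def)
    next
      case False
      then have "w k" using S(2)[of "k - ?L"] by simp
      moreover have "psi E ?x k"
      proof (rule psi_default)
        fix m assume "enat m \<le> plen ?x"
        then have "alen E ?x m \<le> alen E ?x (length es)" using alen_add[of m "length es - m" ?x E] by simp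
        then show "alen E ?x m \<le> k" using False by (simp add: alen_def ptake_FinP)
      qed
      ultimately show ?thesis by simp
    qed
    then show ?thesis using x by (intro bexI[of _ ?x]) auto
  next
    case False
    then have step: "P (es @ [SOME e. P (es @ [e])])" if "P es" for es
      using that by (metis someI_ex)
    define g where "g = rec_nat [] (\<lambda>_ es. es @ [SOME e. P (es @ [e])])"
    have g: "g 0 = []" "\<And>n. g (Suc n) = g n @ [SOME e. P (g n @ [e])]" by (simp_all add: g_def)
    have Pg: "P (g n)" for n
      by (induction n) (auto simp: g step, simp add: P_def v)
    define f where "f n = (SOME e. P (g n @ [e]))" for n
    let ?x = "InfP f :: ('v,'e) bpath"
    have gf: "ptake ?x n = g n" for n
      by (induction n) (simp_all add: g f_def ptake_Suc)
    have fp: "fin_path E v (ptake ?x n)" and wp: "word_prefix (acode E (ptake ?x n)) w" for n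
      using Pg[of n] by (auto simp: gf P_def)
    have "f i \<in> edges E \<and> grange E (f i) = gsource E (f (Suc i))" for i
      using fp[of "Suc i"] fp[of "Suc (Suc i)", unfolded ptake_Suc[of ?x "Suc i"] fin_path_snoc]
      by (auto simp: ptake_Suc fin_path_snoc prange_def)
    then have inf: "inf_path E f" by (simp add: inf_path_def)
    have "gsource E (f 0) = v" using fp[of "Suc 0"] by (simp add: ptake_Suc fin_path_def)
    moreover have "psi E ?x k = w k" for k
    proof -
      obtain m where "Suc k \<le> alen E ?x m" using alen_unbounded[OF cg cL nst inf] by blast
      then show ?thesis using word_prefix_psi[of m ?x E] wp[of m] by (auto simp: word_prefix_def alen_def)
    qed
    ultimately show ?thesis using inf by (intro bexI[of _ ?x]) (auto simp: bdry_def)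
  qed
qed

lemma cyl_iff: "x \<in> cyl E v es \<longleftrightarrow>
    x \<in> bdry E \<and> psource E x = v \<and> enat (length es) \<le> plen x \<and> ptake x (length es) = es"
  by (auto simp: cyl_def is_pref_iff)

lemma openin_cyl_Diff:
  assumes "fin_path E v es" "finite F" "F \<subseteq> emits E (prange E v es)"
  shows "openin (bdry_top E) (cyl E v es - (\<Union>e\<in>F. cyl E v (es @ [e])))"
  unfolding bdry_top_def by (rule topology_generated_by_Basis) (use assms in \<open>auto simp: bdry_basis_def\<close>)

lemma openin_cyl: "fin_path E v es \<Longrightarrow> openin (bdry_top E) (cyl E v es)"
  using openin_cyl_Diff[of v es "{}"] by simp

lemma topspace_bdry: "topspace (bdry_top E) = bdry E"
proof
  show "topspace (bdry_top E) \<subseteq> bdry E"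
    unfolding bdry_top_def topology_generated_by_topspace by (auto simp: bdry_basis_def cyl_def)
  show "bdry E \<subseteq> topspace (bdry_top E)"
  proof
    fix x assume "x \<in> bdry E"
    then have "x \<in> cyl E (psource E x) []" "psource E x \<in> verts E"
      using psource_in_verts[OF cg] by (auto simp: cyl_iff zero_enat_def[symmetric])
    then show "x \<in> topspace (bdry_top E)" using openin_cyl[of "psource E x" "[]"] openin_subset by fastforce
  qed
qed

lemma psi_cyl:
  assumes "fin_path E v es"
  shows "psi E ` cyl E v es = {w. word_prefix (acode E es) w}"
proof
  show "psi E ` cyl E v es \<subseteq> {w. word_prefix (acode E es) w}"
    using is_pref_iff_word_prefix assms by (auto simp: cyl_def is_pref_iff)
  show "{w. word_prefix (acode E es) w} \<subseteq> psi E ` cyl E v es"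
  proof clarsimp
    fix w assume w: "word_prefix (acode E es) w"
    have "v \<in> verts E" using assms by (simp add: fin_path_def)
    then obtain x where "x \<in> bdry E" "psource E x = v" "psi E x = w" using psi_surj by blast
    then show "w \<in> psi E ` cyl E v es" using w is_pref_iff_word_prefix[of x es] assms by (auto simp: cyl_def)
  qed
qed

text \<open>Fixing the source makes \<open>psi\<close> injective, so images commute with the
  intersections and differences that generate the topology, and cylinders go to word
  cylinders.\<close>

lemma seq_open_psi_image:
  assumes "openin (bdry_top E) U"
  shows "seq_open (psi E ` {x \<in> U. psource E x = v})"
proof -
  have "generate_topology_on (bdry_basis E) U"
    using assms by (simp add: bdry_top_def openin_topology_generated_by_iff)
  \<comment> \<open>Containment in \<open>bdry E\<close> joins the induction because the
    intersection step needs injectivity of \<open>psi\<close>, which is known only there.\<close>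
  then have "U \<subseteq> bdry E \<and> seq_open (psi E ` {x \<in> U. psource E x = v})"
  proof induction
    case Empty
    show ?case by (simp add: seq_open_def)
  next
    case (Int a b)
    have "psi E ` {x \<in> a \<inter> b. psource E x = v} =
        psi E ` {x \<in> a. psource E x = v} \<inter> psi E ` {x \<in> b. psource E x = v}"
      using Int.IH psi_inj by (auto simp: image_iff) (metis subsetD)
    then show ?case using Int.IH by (auto intro: seq_open_Int)
  next
    case (UN K)
    have "psi E ` {x \<in> \<Union>K. psource E x = v} = \<Union>((\<lambda>k. psi E ` {x \<in> k. psource E x = v}) ` K)" by auto
    moreover have "seq_open (\<Union>((\<lambda>k. psi E ` {x \<in> k. psource E x = v}) ` K))"
      by (rule seq_open_Union) (use UN.IH in auto)
    moreover have "\<Union>K \<subseteq> bdry E" using UN.IH by blast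
    ultimately show ?case by simp
  next
    case (Basis s)
    then obtain v' es F where s: "s = cyl E v' es - (\<Union>e\<in>F. cyl E v' (es @ [e]))"
      "fin_path E v' es" "finite F" "F \<subseteq> emits E (prange E v' es)"
      by (auto simp: bdry_basis_def)
    have "s \<subseteq> bdry E" unfolding s(1) by (auto simp: cyl_def)
    moreover have "seq_open (psi E ` {x \<in> s. psource E x = v})"
    proof (cases "v = v'")
      case True
      have inj: "inj_on (psi E) (cyl E v' [])" by (rule inj_onI) (auto simp: cyl_iff intro: psi_inj)
      have sub: "cyl E v' ds \<subseteq> cyl E v' []" for ds by (auto simp: cyl_iff zero_enat_def[symmetric])
      have "{x \<in> s. psource E x = v} = s" unfolding s(1) using True by (auto simp: cyl_iff)
      moreover have "psi E ` s = psi E ` cyl E v' es - (\<Union>e\<in>F. psi E ` cyl E v' (es @ [e]))"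
        unfolding s(1) using inj_on_image_set_diff[OF inj, of "cyl E v' es" "\<Union>e\<in>F. cyl E v' (es @ [e])"]
          sub by (simp add: image_UN) blast
      moreover have "psi E ` cyl E v' (es @ [e]) = {w. word_prefix (acode E (es @ [e])) w}" if "e \<in> F" for e
        by (rule psi_cyl) (use s that in \<open>auto simp: fin_path_snoc emits_def\<close>)
      ultimately have eq: "psi E ` {x \<in> s. psource E x = v} =
          {w. word_prefix (acode E es) w} - (\<Union>u\<in>(\<lambda>e. acode E (es @ [e])) ` F. {w. word_prefix u w})"
        using psi_cyl[OF s(2)] by simp
      show ?thesis unfolding eq by (rule seq_open_Diff_word_prefix[OF seq_open_word_prefix]) (use s(3) in simp)
    next
      case False
      then have eq: "{x \<in> s. psource E x = v} = {}" unfolding s(1) by (auto simp: cyl_iff)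
      show ?thesis unfolding eq by (simp add: seq_open_def)
    qed
    ultimately show ?case ..
  qed
  then show ?thesis ..
qed

lemma psi_continuous:
  assumes x: "x \<in> bdry E"
  shows "\<exists>U. openin (bdry_top E) U \<and> x \<in> U \<and> (\<forall>y\<in>U. \<forall>i<n. psi E y i = psi E x i)"
proof (cases "\<exists>m. enat m \<le> plen x \<and> n \<le> alen E x m")
  case True
  then obtain m where m: "enat m \<le> plen x" "n \<le> alen E x m" by blast
  let ?U = "cyl E (psource E x) (ptake x m)"
  have "openin (bdry_top E) ?U" by (rule openin_cyl[OF fin_path_ptake[OF cg x m(1)]])
  moreover have "x \<in> ?U" using x m by (simp add: cyl_iff)
  moreover have "psi E y i = psi E x i" if "y \<in> ?U" "i < n" for y i
    using word_prefix_psi[OF m(1), of E] word_prefix_psi[of m y E] that m(2) by (auto simp: cyl_iff word_prefix_def alen_def)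
  ultimately show ?thesis by blast
next
  case False
  \<comment> \<open>Infinite paths have arbitrarily long words, so a path whose words all stay
    shorter than \<open>n\<close> is finite.\<close>
  then obtain v es where xe: "x = FinP v es"
    using alen_unbounded[OF cg cL nst, of _ n] x by (cases x) (auto simp: bdry_def)
  let ?S = "emits E (prange E v es)" and ?L = "length (acode E es)"
  have es: "fin_path E v es" "infinite ?S"
    using x psource_in_verts[OF cg x] ns cg unfolding xe
    by (auto simp: bdry_def singular_def no_sinks_def prange_def countable_graph_def fin_path_def subset_iff split: if_splits)
  \<comment> \<open>These are the edges whose words could produce a 0 among the \<open>n\<close>
    letters following the word of \<open>es\<close>; all other words begin with \<open>n\<close>
    ones.\<close>
  define F where "F = {e\<in>?S. \<not> (\<forall>z. word_prefix (code ?S e) z \<longrightarrow> (\<forall>i<n. z i))}"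
  have F: "finite F" unfolding F_def by (rule finite_short_codes[OF countable_emits[OF cg] es(2)])
  let ?U = "cyl E v es - (\<Union>e\<in>F. cyl E v (es @ [e]))"
  have oU: "openin (bdry_top E) ?U" by (rule openin_cyl_Diff[OF es(1) F]) (auto simp: F_def)
  have xU: "x \<in> ?U" using x unfolding xe by (auto simp: cyl_iff ptake_FinP)
  \<comment> \<open>A nearby path either continues by an edge outside \<open>F\<close> or stops. Its
    letters from \<open>?L\<close> on and below \<open>n\<close> are 1 in both cases, by the edge
    word or by default.\<close>
  have key: "psi E y i" if y: "y \<in> ?U" "i < n" "?L \<le> i" for y i
  proof -
    have y': "y \<in> bdry E" "psource E y = v" "enat (length es) \<le> plen y" "ptake y (length es) = es"
      using y(1) by (auto simp: cyl_iff)
    show ?thesis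
    proof (cases "enat (length es) < plen y")
      case True
      then have le: "enat (Suc (length es)) \<le> plen y" by (cases y) auto
      let ?e = "pedge y (length es)"
      have e: "?e \<in> ?S" using next_edge[OF cg y'(1) True] y' by simp
      have "y \<in> cyl E v (es @ [?e])" using y' le by (simp add: cyl_iff ptake_Suc)
      then have "?e \<notin> F" using y(1) by blast
      moreover have "word_prefix (code ?S ?e) (\<lambda>i. psi E y (i + ?L))"
        using word_prefix_psi[OF le, of E] y'(4) e by (simp add: ptake_Suc word_prefix_append alpha_def emits_def)
      ultimately have "\<forall>i<n. psi E y (i + ?L)" using e unfolding F_def by blast
      then show ?thesis using y(2,3) by (metis le_add_diff_inverse2 less_imp_diff_less)
    next
      case False
      show ?thesis
      proof (rule psi_default)
        fix m assume m: "enat m \<le> plen y"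
        also have "\<dots> = enat (length es)" using False y'(3) by simp
        finally have "alen E y m \<le> alen E y (length es)"
          using alen_add[of m "length es - m" y E] y'(3) by simp
        then show "alen E y m \<le> i" using y'(4) y(3) by (simp add: alen_def)
      qed
    qed
  qed
  have "psi E y i = psi E x i" if y: "y \<in> ?U" "i < n" for y i
  proof (cases "i < ?L")
    case True
    then show ?thesis
      using word_prefix_psi[of "length es" y E] word_prefix_psi[of "length es" x E] y(1) xU by (auto simp: cyl_iff word_prefix_def)
  next
    case False
    then show ?thesis using key[OF y] key[OF xU y(2)] by simp
  qed
  with oU xU show ?thesis by (intro exI[of _ ?U] conjI ballI allI impI)
qed

lemma alen_locally_constant:
  assumes x: "x \<in> bdry E" "enat m \<le> plen x"
  shows "\<exists>U. openin (bdry_top E) U \<and> x \<in> U \<and> (\<forall>y\<in>U. alen E y m = alen E x m)"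
  using openin_cyl[OF fin_path_ptake[OF cg x]] x
  by (intro exI[of _ "cyl E (psource E x) (ptake x m)"]) (auto simp: cyl_iff alen_def)

text \<open>Finite paths are separated by the length of what remains. For an infinite path, equal
  shifts at \<open>m < n\<close> make the tail periodic, and equal word lengths make the word of one
  period empty; then no edge of the tail has a nonempty word, against
  \<open>ex_nonempty_code\<close>.\<close>

lemma alen_aperiodic:
  assumes x: "x \<in> bdry E" "enat m \<le> plen x" "enat n \<le> plen x"
    and eq: "(shift E ^^ m) x = (shift E ^^ n) x" "alen E x m = alen E x n"
  shows "m = n"
proof -
  have *: False if mn: "m < n" "enat m \<le> plen x" "enat n \<le> plen x"
    "(shift E ^^ m) x = (shift E ^^ n) x" "alen E x m = alen E x n" for m n
  proof (cases x)
    case (FinP v es)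
    then show ?thesis using mn by (auto simp: shift_FinP dest: arg_cong[of "drop m es" _ length])
  next
    case (InfP f)
    define h where "h = (\<lambda>i. f (i + m))"
    define d where "d = n - m"
    have d: "d > 0" "n = m + d" using mn by (auto simp: d_def)
    have "(\<lambda>i. f (i + m)) = (\<lambda>i. f (i + n))" using mn(4) by (simp add: InfP shift_InfP)
    from fun_cong[OF this] have per: "h (i + d) = h i" for i
      unfolding h_def d(2) by (simp only: ac_simps)
    have "alen E (InfP h) d = 0"
      using alen_add[of m d x E] mn(5) d unfolding InfP by (simp add: shift_InfP h_def)
    then have nil: "alpha E (h i) = []" if "i < d" for i
      using that by (auto simp: alen_def acode_def ptake_def)
    have "alpha E (h i) = []" for i
    proof (induction i rule: less_induct)
      case (less i)
      show ?case using less[of "i - d"] nil[of i] per[of "i - d"] d by (cases "i < d") auto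
    qed
    moreover have "inf_path E h" using x(1) inf_path_tail unfolding InfP h_def by (auto simp: bdry_def)
    ultimately show False using ex_nonempty_code[OF cg cL nst] by blast
  qed
  show ?thesis using *[of m n] *[of n m] assms by (metis nat_neq_iff)
qed

end

section \<open>The lag cocycle\<close>

definition gvalid :: "('v,'e) graph \<Rightarrow> ('v,'e) bpath \<Rightarrow> nat \<Rightarrow> nat \<Rightarrow> ('v,'e) bpath \<Rightarrow> bool" where
  "gvalid E x m n y \<longleftrightarrow> enat m \<le> plen x \<and> enat n \<le> plen y \<and> (shift E ^^ m) x = (shift E ^^ n) y"

text \<open>The lag after coding. An arrow records only a difference of shift lengths, so the value
  is taken from an arbitrary witnessing pair; \<open>gvalid_alen_eq\<close> gives independence of
  it.\<close>

definition glag :: "('v,'e) graph \<Rightarrow> ('v,'e) gg_arrow \<Rightarrow> int" where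
  "glag E g = (case g of (x, k, y) \<Rightarrow>
     (SOME l. \<exists>m n. gvalid E x m n y \<and> k = int m - int n \<and> l = int (alen E x m) - int (alen E y n)))"

lemma gg_arrows_iff: "(x, k, y) \<in> gg_arrows E \<longleftrightarrow>
    x \<in> bdry E \<and> y \<in> bdry E \<and> (\<exists>m n. gvalid E x m n y \<and> k = int m - int n)"
  by (auto simp: gg_arrows_def gvalid_def)

lemma gvalid_commute: "gvalid E x m n y \<longleftrightarrow> gvalid E y n m x"
  by (auto simp: gvalid_def)

text \<open>After the first shifts both paths have become the same path, so shifting on adds equally
  many letters on both sides. For the same reason the length bound for \<open>y\<close> implies the
  one for \<open>x\<close>.\<close>

lemma gvalid_raise:
  assumes "gvalid E x m n y" "enat (n + d) \<le> plen y"
  shows "gvalid E x (m + d) (n + d) y"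
    and "int (alen E x (m + d)) - int (alen E y (n + d)) = int (alen E x m) - int (alen E y n)"
proof -
  have eq: "(shift E ^^ m) x = (shift E ^^ n) y" and le: "enat m \<le> plen x" "enat n \<le> plen y"
    using assms(1) by (auto simp: gvalid_def)
  have "plen x - enat m = plen y - enat n"
    using plen_shift[OF le(1), of E] plen_shift[OF le(2), of E] eq by simp
  then have le': "enat (m + d) \<le> plen x"
    using assms(2) le by (cases "plen x"; cases "plen y") auto
  have "(shift E ^^ (d + m)) x = (shift E ^^ (d + n)) y"
    unfolding funpow_add using eq by simp
  then show "gvalid E x (m + d) (n + d) y"
    using assms(2) le' by (simp add: gvalid_def add.commute)
  show "int (alen E x (m + d)) - int (alen E y (n + d)) = int (alen E x m) - int (alen E y n)"
    using alen_add[OF le', of E] alen_add[OF assms(2), of E] eq by simp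
qed

lemma gvalid_alen_eq:
  assumes "gvalid E x m n y" "gvalid E x p q y" "int m - int n = int p - int q"
  shows "int (alen E x m) - int (alen E y n) = int (alen E x p) - int (alen E y q)"
proof -
  have *: "int (alen E x m) - int (alen E y n) = int (alen E x p) - int (alen E y q)"
    if "gvalid E x m n y" "gvalid E x p q y" "int m - int n = int p - int q" "m \<le> p" for m n p q
  proof -
    have "p = m + (p - m)" "q = n + (p - m)" using that by linarith+
    then show ?thesis using gvalid_raise(2)[OF that(1), of "p - m"] that(2) by (simp add: gvalid_def)
  qed
  show ?thesis using *[of m n p q] *[of p q m n] assms by linarith
qed

lemma glag_eq:
  assumes "gvalid E x m n y"
  shows "glag E (x, int m - int n, y) = int (alen E x m) - int (alen E y n)"
  unfolding glag_def prod.case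
proof (rule some_equality)
  show "\<exists>p q. gvalid E x p q y \<and> int m - int n = int p - int q \<and>
      int (alen E x m) - int (alen E y n) = int (alen E x p) - int (alen E y q)"
    using assms by blast
next
  fix l assume "\<exists>p q. gvalid E x p q y \<and> int m - int n = int p - int q \<and>
      l = int (alen E x p) - int (alen E y q)"
  then obtain p q where "gvalid E x p q y" "int m - int n = int p - int q"
    "l = int (alen E x p) - int (alen E y q)" by blast
  then show "l = int (alen E x m) - int (alen E y n)" using gvalid_alen_eq[OF assms] by simp
qed

text \<open>Composition requires the same number of edges of \<open>y\<close> to be deleted by both
  arrows; raising both pairs to \<open>max n p\<close> achieves this without changing the
  differences.\<close>

lemma gvalid_common:
  assumes "gvalid E x m n y" "gvalid E y p q z"
  obtains r t s where "gvalid E x r t y" "gvalid E y t s z" "gvalid E x r s z"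
    "int r - int t = int m - int n" "int t - int s = int p - int q"
proof -
  define t where "t = max n p"
  have le: "enat t \<le> plen y" using assms by (auto simp: t_def max_def gvalid_def)
  have t: "n + (t - n) = t" "p + (t - p) = t" by (auto simp: t_def)
  have 1: "gvalid E x (m + (t - n)) t y"
    using gvalid_raise(1)[OF assms(1), of "t - n"] le t by simp
  have 2: "gvalid E y t (q + (t - p)) z"
    using gvalid_raise(1)[of E z q p y "t - p"] assms(2) le t by (simp add: gvalid_commute)
  have 3: "gvalid E x (m + (t - n)) (q + (t - p)) z" using 1 2 by (auto simp: gvalid_def)
  show ?thesis by (rule that[OF 1 2 3]) (use t in linarith)+
qed

lemma glag_comp:
  assumes "(x, k, y) \<in> gg_arrows E" "(y, l, z) \<in> gg_arrows E"
  shows "glag E (x, k + l, z) = glag E (x, k, y) + glag E (y, l, z)"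
proof -
  obtain m n p q where *: "gvalid E x m n y" "k = int m - int n" "gvalid E y p q z" "l = int p - int q"
    using assms by (auto simp: gg_arrows_iff)
  obtain r t s where r: "gvalid E x r t y" "gvalid E y t s z" "gvalid E x r s z"
    "int r - int t = int m - int n" "int t - int s = int p - int q"
    by (rule gvalid_common[OF *(1,3)])
  have k: "k = int r - int t" and l: "l = int t - int s" and kl: "k + l = int r - int s" using * r by auto
  show ?thesis
    using glag_eq[OF r(1), folded k] glag_eq[OF r(2), folded l] glag_eq[OF r(3), folded kl] by simp
qed

text \<open>Following the first arrow and then the inverse of the second gives two shift lengths
  \<open>r\<close> and \<open>s\<close> with the same effect on \<open>x\<close>. Equal coded lags
  make the deleted words equally long, and aperiodicity yields \<open>r = s\<close>.\<close>

lemma (in coded_graph) glag_inj: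
  assumes "(x, k, y) \<in> gg_arrows E" "(x, l, y) \<in> gg_arrows E" "glag E (x, k, y) = glag E (x, l, y)"
  shows "k = l"
proof -
  obtain m n p q where *: "gvalid E x m n y" "k = int m - int n" "gvalid E x p q y" "l = int p - int q"
    using assms by (auto simp: gg_arrows_iff)
  obtain r t s where r: "gvalid E x r t y" "gvalid E y t s x" "gvalid E x r s x"
    "int r - int t = int m - int n" "int t - int s = int q - int p"
    by (rule gvalid_common[OF *(1), of q p x]) (use *(3) gvalid_commute in blast)
  have k: "k = int r - int t" and l: "l = int s - int t" using * r by auto
  have "gvalid E x s t y" using r(2) by (simp add: gvalid_commute)
  then have "alen E x r = alen E x s"
    using glag_eq[OF r(1), folded k] glag_eq[of E x s t y, folded l] assms(3) by simp
  then have "r = s"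
    using alen_aperiodic[of x r s] assms(1) r(3) by (auto simp: gg_arrows_iff gvalid_def)
  then show ?thesis using k l by simp
qed

lemma psi_gvalid:
  assumes "gvalid E x m n y"
  shows "psi E x (i + alen E x m) = psi E y (i + alen E y n)"
  using assms psi_shift[of m x E i] psi_shift[of n y E i] by (simp add: gvalid_def)

section \<open>Equivalence bispaces\<close>

text \<open>In a locally compact Hausdorff space closedness can be tested on compact sets, so
  compactness of the preimages of compact sets suffices.\<close>

lemma proper_mrw_imp_closed_map:
  assumes "continuous_map X Y f" "proper_mrw X Y f" "Hausdorff_space Y" "locally_compact_space Y"
  shows "closed_map X Y f"
  using assms
  by (intro proper_imp_closed_map compact_imp_proper_map)
    (auto simp: proper_mrw_def locally_compact_imp_k_space Hausdorff_imp_kc_space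
      continuous_map_def)

text \<open>The image of the non-unit part of the orbit map is closed and misses the diagonal; off it, points
  with equal moment can only be related by units.\<close>
lemma orbit_map_locally_injective:
  assumes cl: "closed_map D (prod_topology Z Z) T"
    and D0: "openin D D0"
    and free: "\<And>d. d \<in> topspace D \<Longrightarrow> fst (T d) = snd (T d) \<Longrightarrow> d \<in> D0"
    and triv: "\<And>d. d \<in> D0 \<Longrightarrow> fst (T d) = snd (T d)"
    and orb: "\<And>z w. z \<in> topspace Z \<Longrightarrow> w \<in> topspace Z \<Longrightarrow> p z = p w \<Longrightarrow> \<exists>d\<in>topspace D. T d = (z, w)"
    and z: "z \<in> topspace Z"
  shows "\<exists>U. openin Z U \<and> z \<in> U \<and> inj_on p U"
proof -
  let ?C = "T ` (topspace D - D0)"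
  have "closedin (prod_topology Z Z) ?C" using cl D0 by (auto simp: closed_map_def)
  then have oC: "openin (prod_topology Z Z) (topspace (prod_topology Z Z) - ?C)" by blast
  have "(z, z) \<notin> ?C"
  proof
    assume "(z, z) \<in> ?C"
    then obtain d where d: "d \<in> topspace D" "d \<notin> D0" "T d = (z, z)" by auto
    then show False using free[OF d(1)] by simp
  qed
  then have "(z, z) \<in> topspace (prod_topology Z Z) - ?C" using z by simp
  from openin_prod_topology_alt[THEN iffD1, OF oC, rule_format, OF this]
  obtain U V where UV: "openin Z U" "openin Z V" "z \<in> U" "z \<in> V"
    "U \<times> V \<subseteq> topspace (prod_topology Z Z) - ?C" by (elim exE conjE) (rule that)
  have "inj_on p (U \<inter> V)"
  proof (rule inj_onI)
    fix a b assume ab: "a \<in> U \<inter> V" "b \<in> U \<inter> V" "p a = p b"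
    have "a \<in> topspace Z" "b \<in> topspace Z" using ab UV(1) openin_subset by blast+
    then obtain d where d: "d \<in> topspace D" "T d = (a, b)" using orb ab(3) by blast
    have "(a, b) \<notin> ?C" using ab UV(5) by blast
    then have "d \<in> D0" using d by (metis DiffI imageI)
    then show "a = b" using triv d(2) by fastforce
  qed
  then show ?thesis using UV by (intro exI[of _ "U \<inter> V"]) auto
qed

text \<open>A closed injection has a continuous inverse on its image: the complement of the image of
  \<open>topspace D - N\<close> is the required neighbourhood.\<close>

lemma closed_injective_inverse_continuous:
  assumes cl: "closed_map D Y T" and inj: "inj_on T (topspace D)"
    and N: "openin D N" "d \<in> N" and Y: "T d \<in> topspace Y"
  shows "\<exists>W. openin Y W \<and> T d \<in> W \<and> (\<forall>c\<in>topspace D. T c \<in> W \<longrightarrow> c \<in> N)"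
proof -
  let ?C = "T ` (topspace D - N)"
  have "closedin Y ?C" using cl N by (auto simp: closed_map_def)
  then have "openin Y (topspace Y - ?C)" by blast
  moreover have "d \<in> topspace D" using N openin_subset by blast
  then have "T d \<in> topspace Y - ?C" using Y inj N(2) by (auto dest: inj_onD)
  ultimately show ?thesis by (intro exI[of _ "topspace Y - ?C"]) auto
qed

lemma groupoid_cancel_right:
  assumes "is_groupoid G" "g \<in> arrows G" "h \<in> arrows G" "gsrc G g = gsrc G h"
    and "gcomp G g (ginv G h) \<in> units G"
  shows "g = h"
proof -
  note G = is_groupoidD[OF assms(1)]
  have c: "(g, ginv G h) \<in> composable G" "(ginv G h, h) \<in> composable G"
    using assms G(3,13,14) by (auto simp: composable_def)
  have "gcomp G g (ginv G h) = gsrc G (gcomp G g (ginv G h))" using G(5)[OF assms(5)] by simp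
  also have "\<dots> = grng G h" using G(10)[OF c(1)] G(13)[OF assms(3)] by simp
  finally have "gcomp G (gcomp G g (ginv G h)) h = h" using G(7)[OF assms(3)] by simp
  then show ?thesis using G(12)[OF c] G(16)[OF assms(3)] G(8)[OF assms(2)] assms(4) by simp
qed

lemma groupoid_cancel_left:
  assumes "is_groupoid G" "g \<in> arrows G" "h \<in> arrows G" "grng G g = grng G h"
    and "gcomp G (ginv G h) g \<in> units G"
  shows "g = h"
proof -
  note G = is_groupoidD[OF assms(1)]
  have c: "(h, ginv G h) \<in> composable G" "(ginv G h, g) \<in> composable G"
    using assms G(3,13,14) by (auto simp: composable_def)
  have "gcomp G (ginv G h) g = grng G (gcomp G (ginv G h) g)" using G(6)[OF assms(5)] by simp
  also have "\<dots> = gsrc G h" using G(11)[OF c(2)] G(14)[OF assms(3)] by simp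
  finally have "gcomp G h (gcomp G (ginv G h) g) = h" using G(8)[OF assms(3)] by simp
  then show ?thesis using G(12)[OF c] G(15)[OF assms(3)] G(7)[OF assms(2)] assms(4) by simp
qed

section \<open>Free actions and moment maps of a bispace\<close>

locale equivalence_bispace =
  fixes H :: "('h,'x) groupoid_scheme" and G :: "('g,'y) groupoid_scheme" and Z :: "'z topology"
    and rho :: "'z \<Rightarrow> 'h" and lact :: "'h \<Rightarrow> 'z \<Rightarrow> 'z"
    and sig :: "'z \<Rightarrow> 'g" and ract :: "'z \<Rightarrow> 'g \<Rightarrow> 'z"
  assumes equiv: "groupoid_equivalence H G Z rho lact sig ract"
    and oH: "openin (gtop H) (units H)" and oG: "openin (gtop G) (units G)"
begin

lemma tgH: "top_groupoid H" and tgG: "top_groupoid G"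
  and gH: "is_groupoid H" and gG: "is_groupoid G"
  and topH: "topspace (gtop H) = arrows H" and topG: "topspace (gtop G) = arrows G"
  and hZ: "Hausdorff_space Z" and lZ: "locally_compact_space Z"
  and pl: "principal_left_space H Z rho lact" and pr: "principal_right_space G Z sig ract"
  using equiv by (auto simp: groupoid_equivalence_def top_groupoid_def)

lemma topspace_unit_top [simp]: "topspace (unit_top H) = units H" "topspace (unit_top G) = units G"
  using topH topG is_groupoidD(4)[OF gH] is_groupoidD(4)[OF gG] by (auto simp: unit_top_def)

lemma hZZ: "Hausdorff_space (prod_topology Z Z)" and lZZ: "locally_compact_space (prod_topology Z Z)"
  using hZ lZ by (auto simp: Hausdorff_space_prod_topology locally_compact_space_prod_topology)

lemma rho_cont: "continuous_map Z (unit_top H) rho" and rho_open: "open_map Z (unit_top H) rho"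
  and sig_cont: "continuous_map Z (unit_top G) sig" and sig_open: "open_map Z (unit_top G) sig"
  using pl pr by (auto simp: principal_left_space_def principal_right_space_def)

lemma sig_in: "z \<in> topspace Z \<Longrightarrow> sig z \<in> units G"
  using sig_cont by (auto simp: continuous_map_def Pi_iff)

lemma rho_surj: "rho ` topspace Z = units H"
  using equiv quotient_imp_surjective_map[of Z "unit_top H" rho] by (auto simp: groupoid_equivalence_def)

lemma lact:
  assumes "g \<in> arrows H" "z \<in> topspace Z" "gsrc H g = rho z"
  shows "lact g z \<in> topspace Z" "rho (lact g z) = grng H g" "sig (lact g z) = sig z"
    "lact g z = z \<Longrightarrow> g \<in> units H"
proof -
  have d: "(g, z) \<in> left_dom H Z rho" using assms by (simp add: left_dom_def)
  have "\<forall>(g,z)\<in>left_dom H Z rho. lact g z \<in> topspace Z \<and> rho (lact g z) = grng H g"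
    "\<forall>(g,z)\<in>left_dom H Z rho. lact g z = z \<longrightarrow> g \<in> units H"
    using pl unfolding principal_left_space_def by (blast elim: conjE)+
  moreover have "\<forall>(g,z)\<in>left_dom H Z rho. sig (lact g z) = sig z"
    using equiv unfolding groupoid_equivalence_def by (elim conjE)
  ultimately show "lact g z \<in> topspace Z" "rho (lact g z) = grng H g" "sig (lact g z) = sig z"
    "lact g z = z \<Longrightarrow> g \<in> units H"
    using d by (auto dest!: bspec[OF _ d])
qed

lemma lact_unit: "z \<in> topspace Z \<Longrightarrow> lact (rho z) z = z"
  using pl by (auto simp: principal_left_space_def)

lemma lact_comp: "(g,h) \<in> composable H \<Longrightarrow> z \<in> topspace Z \<Longrightarrow> gsrc H h = rho z \<Longrightarrow>
    lact (gcomp H g h) z = lact g (lact h z)"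
  using pl unfolding principal_left_space_def left_dom_def composable_def by blast

lemma ract:
  assumes "g \<in> arrows G" "z \<in> topspace Z" "sig z = grng G g"
  shows "ract z g \<in> topspace Z" "sig (ract z g) = gsrc G g" "rho (ract z g) = rho z"
    "ract z g = z \<Longrightarrow> g \<in> units G"
proof -
  have d: "(z, g) \<in> right_dom G Z sig" using assms by (simp add: right_dom_def)
  have "\<forall>(z,g)\<in>right_dom G Z sig. ract z g \<in> topspace Z \<and> sig (ract z g) = gsrc G g"
    "\<forall>(z,g)\<in>right_dom G Z sig. ract z g = z \<longrightarrow> g \<in> units G"
    using pr unfolding principal_right_space_def by (blast elim: conjE)+
  moreover have "\<forall>(z,g)\<in>right_dom G Z sig. rho (ract z g) = rho z"
    using equiv unfolding groupoid_equivalence_def by (elim conjE)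
  ultimately show "ract z g \<in> topspace Z" "sig (ract z g) = gsrc G g" "rho (ract z g) = rho z"
    "ract z g = z \<Longrightarrow> g \<in> units G"
    using d by (auto dest!: bspec[OF _ d])
qed

lemma ract_unit: "z \<in> topspace Z \<Longrightarrow> ract z (sig z) = z"
  using pr by (auto simp: principal_right_space_def)

lemma ract_comp: "(g,h) \<in> composable G \<Longrightarrow> z \<in> topspace Z \<Longrightarrow> sig z = grng G g \<Longrightarrow>
    ract z (gcomp G g h) = ract (ract z g) h"
  using pr unfolding principal_right_space_def right_dom_def composable_def by blast

lemma act_commute:
  "g \<in> arrows H \<Longrightarrow> z \<in> topspace Z \<Longrightarrow> gsrc H g = rho z \<Longrightarrow> h \<in> arrows G \<Longrightarrow> sig z = grng G h \<Longrightarrow>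
    ract (lact g z) h = lact g (ract z h)"
  using equiv unfolding groupoid_equivalence_def left_dom_def right_dom_def by blast

text \<open>Freeness is given for stabilizers. Acting by \<open>ginv G h\<close> on both sides of
  the equation makes \<open>gcomp G g (ginv G h)\<close> a stabilizer of \<open>z\<close>, hence a
  unit.\<close>

lemma ract_free:
  assumes "g \<in> arrows G" "h \<in> arrows G" "z \<in> topspace Z" "sig z = grng G g" "sig z = grng G h"
    and eq: "ract z g = ract z h"
  shows "g = h"
proof (rule groupoid_cancel_right[OF gG assms(1,2)])
  note G = is_groupoidD[OF gG]
  show s: "gsrc G g = gsrc G h"
    using ract(2)[OF assms(1,3,4)] ract(2)[OF assms(2,3,5)] eq by simp
  have c: "(g, ginv G h) \<in> composable G" "(h, ginv G h) \<in> composable G"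
    using assms s G(3,14) by (auto simp: composable_def)
  have "ract z (gcomp G g (ginv G h)) = ract z (gcomp G h (ginv G h))"
    using ract_comp[OF c(1)] ract_comp[OF c(2)] assms by simp
  also have "\<dots> = z" using G(15)[OF assms(2)] assms(5) ract_unit[OF assms(3)] by simp
  finally show "gcomp G g (ginv G h) \<in> units G"
    using ract(4)[OF G(9)[OF c(1)] assms(3)] G(11)[OF c(1)] assms(4) by simp
qed

lemma lact_free:
  assumes "g \<in> arrows H" "h \<in> arrows H" "z \<in> topspace Z" "gsrc H g = rho z" "gsrc H h = rho z"
    and eq: "lact g z = lact h z"
  shows "g = h"
proof (rule groupoid_cancel_left[OF gH assms(1,2)])
  note G = is_groupoidD[OF gH]
  show s: "grng H g = grng H h"
    using lact(2)[OF assms(1,3,4)] lact(2)[OF assms(2,3,5)] eq by simp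
  have c: "(ginv H h, g) \<in> composable H" "(ginv H h, h) \<in> composable H"
    using assms s G(3,13) by (auto simp: composable_def)
  have "lact (gcomp H (ginv H h) g) z = lact (gcomp H (ginv H h) h) z"
    using lact_comp[OF c(1)] lact_comp[OF c(2)] assms by simp
  also have "\<dots> = z" using G(16)[OF assms(2)] assms(5) lact_unit[OF assms(3)] by simp
  finally show "gcomp H (ginv H h) g \<in> units H"
    using lact(4)[OF G(9)[OF c(1)] assms(3)] G(10)[OF c(1)] assms(4) by simp
qed

lemma topspace_right_dom:
  "topspace (subtopology (prod_topology Z (gtop G)) (right_dom G Z sig)) = right_dom G Z sig"
  using topG by (auto simp: right_dom_def)

lemma topspace_left_dom:
  "topspace (subtopology (prod_topology (gtop H) Z) (left_dom H Z rho)) = left_dom H Z rho"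
  using topH by (auto simp: left_dom_def)

lemma closed_map_right:
  "closed_map (subtopology (prod_topology Z (gtop G)) (right_dom G Z sig)) (prod_topology Z Z)
     (\<lambda>(z,g). (z, ract z g))"
proof (rule proper_mrw_imp_closed_map[OF _ _ hZZ lZZ])
  let ?D = "subtopology (prod_topology Z (gtop G)) (right_dom G Z sig)"
  have "continuous_map ?D Z fst" by (intro continuous_map_from_subtopology continuous_map_fst)
  moreover have "continuous_map ?D Z (\<lambda>(z,g). ract z g)" using pr by (simp add: principal_right_space_def)
  ultimately have "continuous_map ?D (prod_topology Z Z) (\<lambda>d. (fst d, (\<lambda>(z,g). ract z g) d))"
    by (rule continuous_map_pairedI)
  then show "continuous_map ?D (prod_topology Z Z) (\<lambda>(z,g). (z, ract z g))"
    by (simp add: case_prod_unfold)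
  show "proper_mrw ?D (prod_topology Z Z) (\<lambda>(z,g). (z, ract z g))"
    using pr by (simp add: principal_right_space_def)
qed

lemma closed_map_left:
  "closed_map (subtopology (prod_topology (gtop H) Z) (left_dom H Z rho)) (prod_topology Z Z)
     (\<lambda>(g,z). (lact g z, z))"
proof (rule proper_mrw_imp_closed_map[OF _ _ hZZ lZZ])
  let ?D = "subtopology (prod_topology (gtop H) Z) (left_dom H Z rho)"
  have "continuous_map ?D Z snd" by (intro continuous_map_from_subtopology continuous_map_snd)
  moreover have "continuous_map ?D Z (\<lambda>(g,z). lact g z)" using pl by (simp add: principal_left_space_def)
  ultimately have "continuous_map ?D (prod_topology Z Z) (\<lambda>d. ((\<lambda>(g,z). lact g z) d, snd d))"
    by (intro continuous_map_pairedI)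
  then show "continuous_map ?D (prod_topology Z Z) (\<lambda>(g,z). (lact g z, z))"
    by (simp add: case_prod_unfold)
  show "proper_mrw ?D (prod_topology Z Z) (\<lambda>(g,z). (lact g z, z))"
    using pl by (simp add: principal_left_space_def)
qed

lemma rho_fibre:
  assumes "z \<in> topspace Z" "w \<in> topspace Z" "rho z = rho w"
  shows "\<exists>g. g \<in> arrows G \<and> sig z = grng G g \<and> ract z g = w"
  using equiv assms unfolding groupoid_equivalence_def right_dom_def by blast

lemma sig_fibre:
  assumes "z \<in> topspace Z" "w \<in> topspace Z" "sig z = sig w"
  shows "\<exists>g. g \<in> arrows H \<and> gsrc H g = rho z \<and> lact g z = w"
  using equiv assms unfolding groupoid_equivalence_def left_dom_def by blast

lemma rho_locally_injective:
  assumes "z \<in> topspace Z" shows "\<exists>U. openin Z U \<and> z \<in> U \<and> inj_on rho U"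
proof (rule orbit_map_locally_injective[OF closed_map_right _ _ _ _ assms])
  let ?D0 = "(topspace Z \<times> units G) \<inter> right_dom G Z sig"
  show "openin (subtopology (prod_topology Z (gtop G)) (right_dom G Z sig)) ?D0"
    using oG by (intro openin_subtopology_Int) (simp add: openin_prod_Times_iff)
  fix d
  show "d \<in> ?D0" if "d \<in> topspace (subtopology (prod_topology Z (gtop G)) (right_dom G Z sig))"
    "fst ((\<lambda>(z,g). (z, ract z g)) d) = snd ((\<lambda>(z,g). (z, ract z g)) d)"
    using that ract(4) unfolding topspace_right_dom by (auto simp: right_dom_def)
  show "fst ((\<lambda>(z,g). (z, ract z g)) d) = snd ((\<lambda>(z,g). (z, ract z g)) d)" if "d \<in> ?D0"
    using that ract_unit is_groupoidD(6)[OF gG] by (auto simp: right_dom_def)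
next
  fix z w assume "z \<in> topspace Z" "w \<in> topspace Z" "rho z = rho w"
  then show "\<exists>d\<in>topspace (subtopology (prod_topology Z (gtop G)) (right_dom G Z sig)).
      (\<lambda>(z,g). (z, ract z g)) d = (z, w)"
    unfolding topspace_right_dom using rho_fibre[of z w] by (auto simp: right_dom_def)
qed

lemma sig_locally_injective:
  assumes "z \<in> topspace Z" shows "\<exists>U. openin Z U \<and> z \<in> U \<and> inj_on sig U"
proof (rule orbit_map_locally_injective[OF closed_map_left _ _ _ _ assms])
  let ?D0 = "(units H \<times> topspace Z) \<inter> left_dom H Z rho"
  show "openin (subtopology (prod_topology (gtop H) Z) (left_dom H Z rho)) ?D0"
    using oH by (intro openin_subtopology_Int) (simp add: openin_prod_Times_iff)
  fix d
  show "d \<in> ?D0" if "d \<in> topspace (subtopology (prod_topology (gtop H) Z) (left_dom H Z rho))"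
    "fst ((\<lambda>(g,z). (lact g z, z)) d) = snd ((\<lambda>(g,z). (lact g z, z)) d)"
    using that lact(4) unfolding topspace_left_dom by (auto simp: left_dom_def)
  show "fst ((\<lambda>(g,z). (lact g z, z)) d) = snd ((\<lambda>(g,z). (lact g z, z)) d)" if "d \<in> ?D0"
    using that lact_unit is_groupoidD(5)[OF gH] by (auto simp: left_dom_def)
next
  fix z w assume "z \<in> topspace Z" "w \<in> topspace Z" "sig z = sig w"
  then show "\<exists>d\<in>topspace (subtopology (prod_topology (gtop H) Z) (left_dom H Z rho)).
      (\<lambda>(g,z). (lact g z, z)) d = (z, w)"
    unfolding topspace_left_dom using sig_fibre[of w z] by (auto simp: left_dom_def)
qed

section \<open>The translation map and the homomorphism given by a section\<close>

text \<open>The translation map of the principal right action: existence of the arrow needs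
  \<open>z\<close> and \<open>w\<close> in one fibre of \<open>rho\<close>, uniqueness is
  freeness.\<close>

definition bracket :: "'z \<Rightarrow> 'z \<Rightarrow> 'g" where
  "bracket z w = (SOME g. g \<in> arrows G \<and> sig z = grng G g \<and> ract z g = w)"

lemma bracket:
  assumes "z \<in> topspace Z" "w \<in> topspace Z" "rho z = rho w"
  shows "bracket z w \<in> arrows G" "grng G (bracket z w) = sig z" "ract z (bracket z w) = w"
    "gsrc G (bracket z w) = sig w"
proof -
  note * = someI_ex[OF rho_fibre[OF assms], folded bracket_def]
  show "bracket z w \<in> arrows G" "grng G (bracket z w) = sig z" "ract z (bracket z w) = w" using * by auto
  then show "gsrc G (bracket z w) = sig w" using ract(2)[of "bracket z w" z] assms(1) by simp
qed

lemma bracket_eqI: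
  assumes "z \<in> topspace Z" "g \<in> arrows G" "grng G g = sig z" "ract z g = w"
  shows "bracket z w = g"
proof -
  have w: "w \<in> topspace Z" "rho z = rho w" using ract(1,3)[of g z] assms by auto
  note b = bracket[OF assms(1) w]
  show ?thesis
    by (rule ract_free[OF b(1) assms(2,1) b(2)[symmetric] assms(3)[symmetric]]) (simp only: b(3) assms(4))
qed

text \<open>The map sending \<open>z\<close> and an arrow to \<open>z\<close> and its translate is a
  closed injection, and the bracket is a component of its inverse. The condition
  \<open>rho z' = rho w'\<close> restricts to the image.\<close>

lemma bracket_continuous:
  assumes zw: "z \<in> topspace Z" "w \<in> topspace Z" "rho z = rho w"
    and N: "openin (gtop G) N" "bracket z w \<in> N"
  shows "\<exists>W. openin (prod_topology Z Z) W \<and> (z,w) \<in> W \<and>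
    (\<forall>z' w'. (z',w') \<in> W \<longrightarrow> rho z' = rho w' \<longrightarrow> bracket z' w' \<in> N)"
proof -
  let ?D = "subtopology (prod_topology Z (gtop G)) (right_dom G Z sig)"
  let ?T = "\<lambda>(z,g). (z, ract z g)" and ?N = "(topspace Z \<times> N) \<inter> right_dom G Z sig"
  have inj: "inj_on ?T (topspace ?D)"
    unfolding topspace_right_dom by (rule inj_onI) (auto simp: right_dom_def intro: ract_free)
  have d: "(z, bracket z w) \<in> ?N" "?T (z, bracket z w) = (z,w)"
    using bracket[OF zw] zw N by (auto simp: right_dom_def)
  have oN: "openin ?D ?N" using N(1) by (intro openin_subtopology_Int) (simp add: openin_prod_Times_iff)
  have "?T (z, bracket z w) \<in> topspace (prod_topology Z Z)" unfolding d(2) using zw by simp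
  from closed_injective_inverse_continuous[OF closed_map_right inj oN d(1) this]
  obtain W where W: "openin (prod_topology Z Z) W" "(z,w) \<in> W"
    "\<forall>c\<in>topspace ?D. ?T c \<in> W \<longrightarrow> c \<in> ?N" unfolding d(2) by (elim exE conjE) (rule that)
  have "bracket z' w' \<in> N" if "(z',w') \<in> W" "rho z' = rho w'" for z' w'
  proof -
    have "z' \<in> topspace Z" "w' \<in> topspace Z" using W(1) that(1) openin_subset by fastforce+
    note b = bracket[OF this that(2)]
    then have "(z', bracket z' w') \<in> topspace ?D"
      unfolding topspace_right_dom using \<open>z' \<in> topspace Z\<close> by (simp add: right_dom_def)
    then have "(z', bracket z' w') \<in> ?N" using bspec[OF W(3)] b(3) that(1) by force
    then show ?thesis by blast
  qed
  then show ?thesis using W(1,2) by blast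
qed

text \<open>The action of \<open>h\<close> read in the trivialization of \<open>Z\<close> by a
  section \<open>s\<close> of \<open>rho\<close>: the arrow that moves the section point over the
  range of \<open>h\<close> to the \<open>h\<close>-translate of the one over its source.\<close>

definition transfer :: "('h \<Rightarrow> 'z) \<Rightarrow> 'h \<Rightarrow> 'g" where
  "transfer s h = bracket (s (grng H h)) (lact h (s (gsrc H h)))"

definition unit_section :: "('h \<Rightarrow> 'z) \<Rightarrow> bool" where
  "unit_section s \<longleftrightarrow> (\<forall>u\<in>units H. s u \<in> topspace Z \<and> rho (s u) = u)"

context
  fixes s :: "'h \<Rightarrow> 'z"
  assumes s: "unit_section s"
begin

lemma unit_sectionD: "u \<in> units H \<Longrightarrow> s u \<in> topspace Z" "u \<in> units H \<Longrightarrow> rho (s u) = u"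
  using s by (auto simp: unit_section_def)

lemma transfer:
  assumes h: "h \<in> arrows H"
  shows "transfer s h \<in> arrows G" "grng G (transfer s h) = sig (s (grng H h))"
    "gsrc G (transfer s h) = sig (s (gsrc H h))"
    "ract (s (grng H h)) (transfer s h) = lact h (s (gsrc H h))"
proof -
  note u = is_groupoidD(1,2)[OF gH h]
  have l: "lact h (s (gsrc H h)) \<in> topspace Z" "rho (lact h (s (gsrc H h))) = grng H h"
    "sig (lact h (s (gsrc H h))) = sig (s (gsrc H h))"
    using lact[OF h unit_sectionD(1)[OF u(1)]] unit_sectionD(2)[OF u(1)] by auto
  note b = bracket[OF unit_sectionD(1)[OF u(2)] l(1)]
  show "transfer s h \<in> arrows G" "grng G (transfer s h) = sig (s (grng H h))"
    "gsrc G (transfer s h) = sig (s (gsrc H h))"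
    "ract (s (grng H h)) (transfer s h) = lact h (s (gsrc H h))"
    using b unit_sectionD(2)[OF u(2)] l by (simp_all add: transfer_def)
qed

text \<open>Both candidates carry the section point over the range of \<open>g\<close> to the same
  point, because the two actions commute; freeness of the right action identifies them.\<close>

lemma transfer_comp:
  assumes gh: "(g,h) \<in> composable H"
  shows "(transfer s g, transfer s h) \<in> composable G"
    and "transfer s (gcomp H g h) = gcomp G (transfer s g) (transfer s h)"
proof -
  have g: "g \<in> arrows H" and h: "h \<in> arrows H" and eq: "gsrc H g = grng H h"
    using gh by (auto simp: composable_def)
  note Hd = is_groupoidD[OF gH]
  note tg = transfer[OF g] and th = transfer[OF h]
  show c: "(transfer s g, transfer s h) \<in> composable G"
    using tg th eq by (auto simp: composable_def)
  have sg: "s (grng H g) \<in> topspace Z" and sv: "s (gsrc H g) \<in> topspace Z" and su: "s (gsrc H h) \<in> topspace Z"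
    and rv: "rho (s (gsrc H g)) = gsrc H g" and ru: "rho (s (gsrc H h)) = gsrc H h"
    using unit_sectionD Hd(1,2) g h by auto
  have "ract (s (grng H g)) (gcomp G (transfer s g) (transfer s h)) =
      ract (lact g (s (gsrc H g))) (transfer s h)"
    using ract_comp[OF c sg] tg by simp
  also have "\<dots> = lact g (ract (s (gsrc H g)) (transfer s h))"
    using act_commute[OF g sv rv[symmetric] th(1)] th(2) eq by simp
  also have "\<dots> = lact (gcomp H g h) (s (gsrc H h))"
    using th(4) eq lact_comp[OF gh su ru[symmetric]] by simp
  finally have "ract (s (grng H g)) (gcomp G (transfer s g) (transfer s h)) = lact (gcomp H g h) (s (gsrc H h))" .
  then show "transfer s (gcomp H g h) = gcomp G (transfer s g) (transfer s h)"
    unfolding transfer_def[of _ "gcomp H g h"] Hd(10)[OF gh] Hd(11)[OF gh]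
    using is_groupoidD(9,11)[OF gG c] tg(2) by (intro bracket_eqI[OF sg]) auto
qed

lemma transfer_inj:
  assumes "h \<in> arrows H" "k \<in> arrows H" "gsrc H h = gsrc H k" "grng H h = grng H k"
    "transfer s h = transfer s k"
  shows "h = k"
proof (rule lact_free[OF assms(1,2)])
  show "s (gsrc H h) \<in> topspace Z" "gsrc H h = rho (s (gsrc H h))" "gsrc H k = rho (s (gsrc H h))"
    using unit_sectionD is_groupoidD(1)[OF gH] assms by auto
  show "lact h (s (gsrc H h)) = lact k (s (gsrc H h))"
    using transfer(4)[OF assms(1)] transfer(4)[OF assms(2)] assms(3-5) by simp
qed

lemma transfer_continuous:
  assumes cs: "continuous_map (unit_top H) Z s"
    and h: "h \<in> arrows H" and N: "openin (gtop G) N" "transfer s h \<in> N"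
  shows "\<exists>W. openin (gtop H) W \<and> h \<in> W \<and> (\<forall>k\<in>W. transfer s k \<in> N)"
proof -
  note Hd = is_groupoidD[OF gH]
  let ?F = "\<lambda>h. (s (grng H h), lact h (s (gsrc H h)))"
  note cu = continuous_map_to_unit_top[OF tgH]
  have 1: "continuous_map (gtop H) Z (\<lambda>h. s (grng H h))" "continuous_map (gtop H) Z (\<lambda>h. s (gsrc H h))"
    using continuous_map_compose[OF cu(2) cs] continuous_map_compose[OF cu(1) cs] by (simp_all add: o_def)
  have "continuous_map (gtop H) (subtopology (prod_topology (gtop H) Z) (left_dom H Z rho))
      (\<lambda>h. (h, s (gsrc H h)))"
    unfolding continuous_map_in_subtopology
    using 1(2) unit_sectionD Hd(1) topH by (auto simp: continuous_map_pairwise o_def left_dom_def)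
  from continuous_map_compose[OF this, of Z "\<lambda>(g,z). lact g z"]
  have 2: "continuous_map (gtop H) Z (\<lambda>h. lact h (s (gsrc H h)))"
    using pl by (simp add: o_def principal_left_space_def)
  have F: "continuous_map (gtop H) (prod_topology Z Z) ?F" using 1 2 by (intro continuous_map_pairedI)
  have r: "rho (s (grng H k)) = rho (lact k (s (gsrc H k)))" "s (grng H k) \<in> topspace Z"
    "lact k (s (gsrc H k)) \<in> topspace Z" if "k \<in> arrows H" for k
    using unit_sectionD Hd(1,2)[OF that] lact(1,2)[OF that unit_sectionD(1)[OF Hd(1)[OF that]]] by auto
  obtain W where W: "openin (prod_topology Z Z) W" "?F h \<in> W"
    "\<forall>z' w'. (z',w') \<in> W \<longrightarrow> rho z' = rho w' \<longrightarrow> bracket z' w' \<in> N"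
    using bracket_continuous[OF r(2)[OF h] r(3)[OF h] r(1)[OF h] N(1)] N(2) unfolding transfer_def by blast
  let ?W = "{k \<in> topspace (gtop H). ?F k \<in> W}"
  have "openin (gtop H) ?W" using F W(1) by (rule openin_continuous_map_preimage)
  moreover have "h \<in> ?W" using h W(2) topH by simp
  moreover have "\<forall>k\<in>?W. transfer s k \<in> N"
    using W(3) r(1) topH by (auto simp: transfer_def)
  ultimately show ?thesis by blast
qed

end

text \<open>Local inverses of \<open>rho\<close> over compact open sets are glued; on disjoint open
  pieces no compatibility is required. \<open>P\<close> stands for any local property inherited by
  subsets, so that the values of \<open>s\<close> over each piece can be kept inside a set that has
  it.\<close>

lemma piecewise_section:
  assumes ne: "units H \<noteq> {}" and sc: "second_countable (unit_top H)"
    and hH: "Hausdorff_space (unit_top H)" and cb: "compact_open_basis (unit_top H)"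
    and P: "\<And>z. z \<in> topspace Z \<Longrightarrow> \<exists>U. openin Z U \<and> z \<in> U \<and> P U"
    and mono: "\<And>U V. P U \<Longrightarrow> V \<subseteq> U \<Longrightarrow> P V"
  obtains s and n :: "'h \<Rightarrow> nat" where
    "\<And>u. u \<in> units H \<Longrightarrow> s u \<in> topspace Z" "\<And>u. u \<in> units H \<Longrightarrow> rho (s u) = u"
    "\<And>k. openin (unit_top H) {u \<in> units H. n u = k}"
    "continuous_map (unit_top H) Z s"
    "\<And>V. openin (unit_top H) V \<Longrightarrow> openin Z (s ` V)"
    "\<And>k. \<exists>U. P U \<and> s ` {u \<in> units H. n u = k} \<subseteq> U"
proof -
  \<comment> \<open>\<open>K\<close> is clopen so that earlier sets can be subtracted from it, and
    small enough for the inverse of \<open>rho\<close> on \<open>U\<close> to be defined over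
    it.\<close>
  define good where "good K U \<longleftrightarrow> openin (unit_top H) K \<and> closedin (unit_top H) K \<and>
     openin Z U \<and> P U \<and> inj_on rho U \<and> K \<subseteq> rho ` U" for K U
  have ex: "\<exists>K U. good K U \<and> u \<in> K" if u: "u \<in> units H" for u
  proof -
    have "u \<in> rho ` topspace Z" using u rho_surj by simp
    then obtain z where z: "z \<in> topspace Z" "rho z = u" by blast
    obtain U1 where U1: "openin Z U1" "z \<in> U1" "P U1" using P[OF z(1)] by blast
    obtain U2 where U2: "openin Z U2" "z \<in> U2" "inj_on rho U2" using rho_locally_injective[OF z(1)] by blast
    let ?U = "U1 \<inter> U2"
    have "openin (unit_top H) (rho ` ?U)" using rho_open U1 U2 by (simp add: open_map_def openin_Int)
    moreover have "u \<in> rho ` ?U" using U1 U2 z by blast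
    ultimately obtain K where K: "openin (unit_top H) K" "compactin (unit_top H) K" "u \<in> K" "K \<subseteq> rho ` ?U"
      using cb unfolding compact_open_basis_def by meson
    have "good K ?U"
      unfolding good_def using K U1 U2 compactin_imp_closedin[OF hH K(2)] mono[OF U1(3), of ?U]
      by (auto intro: openin_Int inj_on_subset)
    then show ?thesis using K(3) by blast
  qed
  have "\<Union>{K. \<exists>U. good K U} = topspace (unit_top H)"
  proof
    show "\<Union>{K. \<exists>U. good K U} \<subseteq> topspace (unit_top H)"
      unfolding good_def using openin_subset by blast
    show "topspace (unit_top H) \<subseteq> \<Union>{K. \<exists>U. good K U}" using ex by auto
  qed
  moreover have "\<forall>K\<in>{K. \<exists>U. good K U}. openin (unit_top H) K" by (auto simp: good_def)
  ultimately obtain \<V> where \<V>: "countable \<V>" "\<V> \<subseteq> {K. \<exists>U. good K U}" "\<Union>\<V> = units H"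
    using second_countable_imp_Lindelof_space[OF sc, unfolded Lindelof_space_def] by (metis topspace_unit_top(1))
  then have "\<V> \<noteq> {}" using ne by auto
  define K where "K = from_nat_into \<V>"
  have rK: "range K = \<V>" unfolding K_def by (rule range_from_nat_into[OF \<open>\<V> \<noteq> {}\<close> \<V>(1)])
  have "\<exists>U. good (K i) U" for i using rK \<V>(2) by blast
  then obtain U where good: "\<And>i. good (K i) (U i)" by metis
  \<comment> \<open>The least index turns the countable clopen cover into a disjoint one.\<close>
  define n where "n u = (LEAST i. u \<in> K i)" for u
  define s where "s u = inv_into (U (n u)) rho u" for u
  have nK: "u \<in> K (n u)" if "u \<in> units H" for u
  proof -
    have "\<exists>i. u \<in> K i" using that \<V>(3) rK by blast
    then show ?thesis unfolding n_def by (rule LeastI_ex)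
  qed
  have s: "s u \<in> U (n u)" "rho (s u) = u" if "u \<in> units H" for u
  proof -
    have "u \<in> rho ` U (n u)" using nK[OF that] good unfolding good_def by blast
    then show "s u \<in> U (n u)" "rho (s u) = u" unfolding s_def by (auto intro: inv_into_into f_inv_into_f)
  qed
  \<comment> \<open>Over its piece, \<open>s\<close> inverts \<open>rho\<close> on all of
    \<open>U k\<close> that lies above; both continuity and openness of \<open>s\<close> rest on
    this.\<close>
  have s_eq: "s (rho z) = z" if "z \<in> U k" "rho z \<in> units H" "n (rho z) = k" for z k
    using s[OF that(2)] that good[of k] unfolding good_def by (auto dest: inj_onD)
  have Utop: "U k \<subseteq> topspace Z" for k using good openin_subset unfolding good_def by blast
  have on: "openin (unit_top H) {u \<in> units H. n u = k}" for k
  proof -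
    have "{u \<in> units H. n u = k} = K k - (\<Union>i<k. K i)"
    proof (intro equalityI subsetI)
      fix u assume u: "u \<in> {u \<in> units H. n u = k}"
      have "u \<notin> K i" if "i < k" for i
        using not_less_Least[of i "\<lambda>i. u \<in> K i"] u that by (simp add: n_def)
      then show "u \<in> K k - (\<Union>i<k. K i)" using nK[of u] u by auto
    next
      fix u assume u: "u \<in> K k - (\<Union>i<k. K i)"
      then have "u \<in> units H" using rK \<V>(3) by blast
      moreover have "n u = k" unfolding n_def using u by (intro Least_equality) (auto simp: not_less[symmetric])
      ultimately show "u \<in> {u \<in> units H. n u = k}" by simp
    qed
    moreover have "closedin (unit_top H) (\<Union>i<k. K i)"
      using good by (intro closedin_Union) (auto simp: good_def)
    ultimately show ?thesis using good[of k] by (simp add: good_def openin_diff)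
  qed
  show ?thesis
  proof (rule that[of s n])
    show "s u \<in> topspace Z" "rho (s u) = u" if "u \<in> units H" for u
      using s[OF that] Utop by auto
    show "openin (unit_top H) {u \<in> units H. n u = k}" for k by (rule on)
    show "\<exists>U. P U \<and> s ` {u \<in> units H. n u = k} \<subseteq> U" for k
      using good[of k] s(1) by (intro exI[of _ "U k"]) (auto simp: good_def)
    show "continuous_map (unit_top H) Z s"
      unfolding continuous_map_def
    proof (intro conjI allI impI)
      show "s \<in> topspace (unit_top H) \<rightarrow> topspace Z" using s(1) Utop by auto
      fix W assume W: "openin Z W"
      have "{u \<in> topspace (unit_top H). s u \<in> W} = (\<Union>k. {u \<in> units H. n u = k} \<inter> rho ` (U k \<inter> W))"
      proof (intro equalityI subsetI)
        fix u assume "u \<in> {u \<in> topspace (unit_top H). s u \<in> W}"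
        then have "u \<in> units H" "s u \<in> W" by auto
        then show "u \<in> (\<Union>k. {u \<in> units H. n u = k} \<inter> rho ` (U k \<inter> W))"
          using s[of u] by (auto intro!: image_eqI[of _ _ "s u"])
      next
        fix u assume "u \<in> (\<Union>k. {u \<in> units H. n u = k} \<inter> rho ` (U k \<inter> W))"
        then show "u \<in> {u \<in> topspace (unit_top H). s u \<in> W}" using s_eq by auto
      qed
      moreover have "openin (unit_top H) (rho ` (U k \<inter> W))" for k
        using rho_open good[of k] W unfolding open_map_def good_def by (blast intro: openin_Int)
      ultimately show "openin (unit_top H) {u \<in> topspace (unit_top H). s u \<in> W}"
        using on by (auto intro!: openin_Union)
    qed
    show "openin Z (s ` V)" if V: "openin (unit_top H) V" for V
    proof -
      have Vu: "V \<subseteq> units H" using V openin_subset by fastforce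
      have "s ` V = (\<Union>k. U k \<inter> {z \<in> topspace Z. rho z \<in> V \<inter> {u \<in> units H. n u = k}})"
      proof (intro equalityI subsetI)
        fix z assume "z \<in> s ` V"
        then obtain u where "u \<in> V" "z = s u" by blast
        then show "z \<in> (\<Union>k. U k \<inter> {z \<in> topspace Z. rho z \<in> V \<inter> {u \<in> units H. n u = k}})"
          using s[of u] Utop[of "n u"] Vu by auto
      next
        fix z assume "z \<in> (\<Union>k. U k \<inter> {z \<in> topspace Z. rho z \<in> V \<inter> {u \<in> units H. n u = k}})"
        then obtain k where "z \<in> U k" "rho z \<in> V" "rho z \<in> units H" "n (rho z) = k" by auto
        then show "z \<in> s ` V" using s_eq by (intro image_eqI[of _ _ "rho z"]) auto
      qed
      moreover have "openin Z (U k \<inter> {z \<in> topspace Z. rho z \<in> V \<inter> {u \<in> units H. n u = k}})" for k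
        using good[of k] rho_cont V on
        by (intro openin_Int openin_continuous_map_preimage) (auto simp: good_def)
      ultimately show ?thesis by (auto intro!: openin_Union)
    qed
  qed
qed

end

section \<open>Injective coding of the unit space\<close>

text \<open>The pieces are indexed by J u, the value of n together with the shortest prefix of p u whose
  cylinder lies in the image of the n-fibre.\<close>
lemma cylinder_coding:
  fixes X :: "'a topology" and n :: "'a \<Rightarrow> nat" and p :: "'a \<Rightarrow> nat \<Rightarrow> bool"
  assumes n: "\<And>k. openin X {u \<in> topspace X. n u = k}"
    and pc: "\<And>u m. u \<in> topspace X \<Longrightarrow> \<exists>U. openin X U \<and> u \<in> U \<and> (\<forall>v\<in>U. \<forall>i<m. p v i = p u i)"
    and po: "\<And>V k. openin X V \<Longrightarrow> seq_open (p ` {u \<in> V. n u = k})"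
    and pinj: "\<And>k. inj_on p {u \<in> topspace X. n u = k}"
  obtains \<beta> and a b :: "'a \<Rightarrow> nat" where
    "\<And>u i. u \<in> topspace X \<Longrightarrow> \<beta> u (i + b u) = p u (i + a u)"
    "\<And>u. u \<in> topspace X \<Longrightarrow> \<exists>U. openin X U \<and> u \<in> U \<and> (\<forall>v\<in>U. a v = a u \<and> b v = b u)"
    "inj_on \<beta> (topspace X)"
    "\<And>u m. u \<in> topspace X \<Longrightarrow> \<exists>U. openin X U \<and> u \<in> U \<and> (\<forall>v\<in>U. \<forall>i<m. \<beta> v i = \<beta> u i)"
    "\<And>U. openin X U \<Longrightarrow> seq_open (\<beta> ` U)"
    "compact_space X \<Longrightarrow> topspace X \<noteq> {} \<Longrightarrow> \<beta> ` topspace X = UNIV"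
proof -
  let ?X = "topspace X"
  define img where "img k = p ` {u \<in> ?X. n u = k}" for k
  define inside where "inside u l \<longleftrightarrow> (\<forall>y. (\<forall>i<l. y i = p u i) \<longrightarrow> y \<in> img (n u))" for u l
  define a where "a u = (LEAST l. inside u l)" for u
  have inside_a: "inside u (a u)" if u: "u \<in> ?X" for u
  proof -
    have "p u \<in> img (n u)" using u by (auto simp: img_def)
    moreover have "seq_open (img (n u))" unfolding img_def by (rule po) simp
    ultimately have "\<exists>l. inside u l" unfolding seq_open_def inside_def by blast
    then show ?thesis unfolding a_def by (rule LeastI_ex)
  qed
  \<comment> \<open>A shorter admissible prefix for \<open>v\<close> would be one for
    \<open>u\<close> too. So the shortest length is constant on the cylinder, and a piece contains
    every point of its \<open>n\<close>-fibre with the given prefix.\<close>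
  have a_eq: "a v = a u" if uv: "u \<in> ?X" "n v = n u" "\<forall>i<a u. p v i = p u i" for u v
    unfolding a_def[of v]
  proof (rule Least_equality)
    show "inside v (a u)" using inside_a[OF uv(1)] uv(2,3) by (auto simp: inside_def)
    fix l assume l: "inside v l"
    show "a u \<le> l"
    proof (rule ccontr)
      assume "\<not> a u \<le> l"
      then have "inside u l" using l uv(2,3) by (auto simp: inside_def)
      then have "a u \<le> l" unfolding a_def by (rule Least_le)
      with \<open>\<not> a u \<le> l\<close> show False ..
    qed
  qed
  define J where "J u = (n u, map (p u) [0..<a u])" for u
  define I where "I = J ` ?X"
  have J_eq: "J v = J u" if "u \<in> ?X" "n v = n u" "\<forall>i<a u. p v i = p u i" for u v
    using a_eq[OF that] that by (simp add: J_def)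
  have J_eqD: "n v = n u" "a v = a u" "\<And>i. i < a u \<Longrightarrow> p v i = p u i" if "J v = J u" for u v
  proof -
    have eq: "map (p v) [0..<a v] = map (p u) [0..<a u]" and "n v = n u" using that by (auto simp: J_def)
    then show "n v = n u" by simp
    show av: "a v = a u" using arg_cong[OF eq, of length] by simp
    show "p v i = p u i" if "i < a u" for i
      using arg_cong[OF eq, of "\<lambda>l. l ! i"] that av by simp
  qed
  have cI: "countable I" by simp
  define b where "b u = length (code I (J u))" for u
  \<comment> \<open>The \<open>a u\<close> letters naming the cylinder give way to the
    \<open>b u\<close> letters naming its piece; all later letters are kept.\<close>
  define \<beta> where "\<beta> u i = (if i < b u then code I (J u) ! i else p u (i - b u + a u))" for u i
  have \<beta>_shift: "\<beta> u (i + b u) = p u (i + a u)" for u i by (simp add: \<beta>_def)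
  have pre: "word_prefix (code I (J u)) (\<beta> u)" for u by (simp add: word_prefix_def \<beta>_def b_def)
  have b_eq: "b v = b u" if "J v = J u" for u v using that by (simp add: b_def)
  have near: "\<exists>U. openin X U \<and> u \<in> U \<and> (\<forall>v\<in>U. J v = J u \<and> (\<forall>i<m. p v i = p u i))"
    if u: "u \<in> ?X" for u m
  proof -
    obtain U where U: "openin X U" "u \<in> U" "\<forall>v\<in>U. \<forall>i<m + a u. p v i = p u i"
      using pc[OF u, of "m + a u"] by blast
    let ?U = "U \<inter> {v \<in> ?X. n v = n u}"
    have "openin X ?U" using U(1) n by blast
    moreover have "u \<in> ?U" using U(2) u by blast
    moreover have "J v = J u \<and> (\<forall>i<m. p v i = p u i)" if "v \<in> ?U" for v
      using J_eq[OF u, of v] U(3) that by simp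
    ultimately show ?thesis by (intro exI[of _ ?U] conjI ballI) blast+
  qed
  \<comment> \<open>This undoes the replacement: a sequence \<open>w\<close> beginning with the word
    of a piece is reached from the point of that piece whose \<open>p\<close>-value is the old
    prefix followed by the remaining letters of \<open>w\<close>.\<close>
  have realize: "\<beta> v = w"
    if "J v = J u" "\<And>i. p v i = (if i < a u then p u i else w (i - a u + b u))" "word_prefix (code I (J u)) w" for u v w
  proof
    fix i
    show "\<beta> v i = w i"
    proof (cases "i < b u")
      case True
      then show ?thesis using that(1,3) b_eq[OF that(1)] by (simp add: \<beta>_def word_prefix_def b_def)
    next
      case False
      then have "\<beta> v i = p v (i - b u + a u)" using b_eq[OF that(1)] J_eqD(2)[OF that(1)] by (simp add: \<beta>_def)
      also have "\<dots> = w (i - b u + a u - a u + b u)" unfolding that(2) by simp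
      also have "\<dots> = w i" using False by simp
      finally show ?thesis .
    qed
  qed
  show ?thesis
  proof (rule that[of \<beta> b a])
    show "\<beta> u (i + b u) = p u (i + a u)" for u i by (rule \<beta>_shift)
    show "\<exists>U. openin X U \<and> u \<in> U \<and> (\<forall>v\<in>U. a v = a u \<and> b v = b u)" if u: "u \<in> ?X" for u
    proof -
      obtain U where U: "openin X U" "u \<in> U" "\<And>v. v \<in> U \<Longrightarrow> J v = J u" using near[OF u] by meson
      have "a v = a u \<and> b v = b u" if "v \<in> U" for v
        using J_eqD(2)[OF U(3)[OF that]] b_eq[OF U(3)[OF that]] by simp
      then show ?thesis using U(1,2) by (intro exI[of _ U] conjI ballI) blast+
    qed
    show "\<exists>U. openin X U \<and> u \<in> U \<and> (\<forall>v\<in>U. \<forall>i<m. \<beta> v i = \<beta> u i)" if u: "u \<in> ?X" for u m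
    proof -
      obtain U where U: "openin X U" "u \<in> U" "\<And>v. v \<in> U \<Longrightarrow> J v = J u"
        "\<And>v i. v \<in> U \<Longrightarrow> i < m + a u \<Longrightarrow> p v i = p u i" using near[OF u, of "m + a u"] by meson
      have "\<beta> v i = \<beta> u i" if "v \<in> U" "i < m" for v i
        using U(3)[OF that(1)] U(4)[OF that(1), of "i - b u + a u"] that(2)
          J_eqD(2)[OF U(3)[OF that(1)]] b_eq[OF U(3)[OF that(1)]]
        by (auto simp: \<beta>_def)
      then show ?thesis using U(1,2) by (intro exI[of _ U] conjI ballI allI impI) blast+
    qed
    show "inj_on \<beta> ?X"
    proof (rule inj_onI)
      fix u v assume uv: "u \<in> ?X" "v \<in> ?X" "\<beta> u = \<beta> v"
      have J: "J v = J u"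
        using code_inj[OF cI, of "J v" "J u" "\<beta> u"] pre[of u] pre[of v] uv by (auto simp: I_def)
      have "p v i = p u i" for i
      proof (cases "i < a u")
        case True
        then show ?thesis by (rule J_eqD(3)[OF J])
      next
        case False
        then show ?thesis
          using fun_cong[OF uv(3), of "i - a u + b u"] \<beta>_shift[of u "i - a u"] \<beta>_shift[of v "i - a u"]
            J_eqD(2)[OF J] b_eq[OF J] by simp
      qed
      then have "p v = p u" ..
      then show "u = v" using pinj[of "n u"] J_eqD(1)[OF J] uv(1,2) by (auto dest: inj_onD)
    qed
    show "seq_open (\<beta> ` V)" if V: "openin X V" for V
      unfolding seq_open_def
    proof
      fix x assume "x \<in> \<beta> ` V"
      then obtain u where u: "u \<in> V" "x = \<beta> u" by blast
      have VX: "V \<subseteq> ?X" using V openin_subset by blast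
      have "p u \<in> p ` {v \<in> V. n v = n u}" using u by blast
      then obtain m where m: "\<And>y. (\<forall>i<m. y i = p u i) \<Longrightarrow> y \<in> p ` {v \<in> V. n v = n u}"
        using po[OF V] unfolding seq_open_def by blast
      \<comment> \<open>Up to \<open>m\<close> letters control \<open>p\<close>; the additional
        \<open>b u\<close> letters account for the word put in place of the prefix.\<close>
      have "w \<in> \<beta> ` V" if w: "\<forall>i<m + b u. w i = x i" for w
      proof -
        let ?y = "\<lambda>i. if i < a u then p u i else w (i - a u + b u)"
        have "?y i = p u i" if "i < m" for i
        proof (cases "i < a u")
          case False
          have "w (i - a u + b u) = x (i - a u + b u)" using that by (intro w[rule_format]) linarith
          then show ?thesis using False u(2) \<beta>_shift[of u "i - a u"] by simp
        qed simp
        then have "?y \<in> p ` {v \<in> V. n v = n u}" by (intro m) simp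
        then obtain v where v: "v \<in> V" "n v = n u" "?y = p v" by auto
        have pv: "p v i = ?y i" for i using v(3) by (simp add: fun_eq_iff)
        have "J v = J u" using u VX by (intro J_eq v) (auto simp: pv)
        moreover have "word_prefix (code I (J u)) w" using pre[of u] w u(2) by (auto simp: word_prefix_def b_def)
        ultimately have "\<beta> v = w" using pv by (intro realize)
        then show ?thesis using v(1) by blast
      qed
      then show "\<exists>n. \<forall>y. (\<forall>i<n. y i = x i) \<longrightarrow> y \<in> \<beta> ` V" by (intro exI[of _ "m + b u"]) simp
    qed
    show "\<beta> ` ?X = UNIV" if comp: "compact_space X" and ne: "?X \<noteq> {}"
    proof -
      let ?C = "\<lambda>j. {u \<in> ?X. J u = j}"
      have "openin X (?C j)" for j
      proof (subst openin_subopen, intro ballI)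
        fix u assume u: "u \<in> ?C j"
        then have "u \<in> ?X" "J u = j" by auto
        then obtain U where U: "openin X U" "u \<in> U" "\<And>v. v \<in> U \<Longrightarrow> J v = j"
          using near[of u] by metis
        have "U \<subseteq> ?C j" using openin_subset[OF U(1)] U(3) by blast
        then show "\<exists>T. openin X T \<and> u \<in> T \<and> T \<subseteq> ?C j" using U(1,2) by (intro exI[of _ U] conjI)
      qed
      \<comment> \<open>The pieces are open, disjoint and nonempty, so a finite subcover contains
        all of them. Hence \<open>I\<close> is finite and its code is complete.\<close>
      then have "\<exists>\<F>. finite \<F> \<and> \<F> \<subseteq> ?C ` I \<and> ?X \<subseteq> \<Union>\<F>"
        using comp unfolding compact_space_alt by (elim allE[of _ "?C ` I"]) (auto simp: I_def)
      then obtain \<F> where \<F>: "finite \<F>" "\<F> \<subseteq> ?C ` I" "?X \<subseteq> \<Union>\<F>" by blast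
      then obtain I' where I': "finite I'" "\<F> = ?C ` I'" by (meson finite_subset_image)
      have "I \<subseteq> I'" using \<F>(3) I'(2) by (auto simp: I_def)
      then have fin: "finite I" using I'(1) finite_subset by blast
      have "w \<in> \<beta> ` ?X" for w
      proof -
        have "\<exists>j\<in>I. word_prefix (code I j) w" using code_total[OF cI, of w] ne fin by (auto simp: I_def)
        then obtain u where u: "u \<in> ?X" and w: "word_prefix (code I (J u)) w" by (auto simp: I_def)
        let ?y = "\<lambda>i. if i < a u then p u i else w (i - a u + b u)"
        \<comment> \<open>The whole cylinder of the prefix lies in the image of the fibre, so every
          continuation of the prefix is attained.\<close>
        have "?y \<in> img (n u)" using inside_a[OF u] unfolding inside_def by simp
        then obtain v where v: "v \<in> ?X" "n v = n u" "?y = p v" by (auto simp: img_def)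
        have pv: "p v i = ?y i" for i using v(3) by (simp add: fun_eq_iff)
        have "J v = J u" by (intro J_eq u v) (auto simp: pv)
        then have "\<beta> v = w" using pv w by (intro realize)
        then show ?thesis using v(1) by blast
      qed
      then show ?thesis by blast
    qed
  qed
qed

section \<open>Boundary paths as the units of the graph groupoid\<close>

lemma (in coded_graph) openin_unit_space:
  assumes U: "openin (bdry_top E) U"
  shows "openin (gtop (graph_groupoid E)) {(x, 0, x) | x. x \<in> U}"
proof -
  have "{(x, 0, x) | x. x \<in> U} = {(x, int 0 - int 0, y) | x y. x \<in> U \<and> y \<in> U \<and>
         (shift E ^^ 0) x = (shift E ^^ 0) y}" by auto
  also have "\<dots> \<in> gg_basic_opens E"
    unfolding gg_basic_opens_def mem_Collect_eq
    by (intro exI conjI) (rule refl, use U in \<open>auto simp: zero_enat_def[symmetric]\<close>)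
  finally show ?thesis unfolding gtop_graph_groupoid by (rule topology_generated_by_Basis)
qed

lemma (in coded_graph) openin_units_graph_groupoid:
  "openin (gtop (graph_groupoid E)) (units (graph_groupoid E))"
  using openin_unit_space[of "bdry E"] topspace_bdry openin_topspace[of "bdry_top E"]
  by (simp add: units_graph_groupoid)

text \<open>On the diagonal the lag is 0, so a basic set contributes nothing unless
  \<open>m = n\<close>, and then the shift condition holds automatically. With
  \<open>openin_unit_space\<close> this identifies the topology of the units with that of the
  boundary paths.\<close>

lemma openin_diagonal_trace:
  assumes "openin (gtop (graph_groupoid E)) W"
  shows "openin (bdry_top E) {x. (x, 0, x) \<in> W}"
proof -
  have "generate_topology_on (gg_basic_opens E) W"
    using assms by (simp add: gtop_graph_groupoid openin_topology_generated_by_iff)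
  then show ?thesis
  proof induction
    case (Int a b)
    then show ?case using openin_Int[OF Int.IH] by (simp add: Collect_conj_eq[symmetric])
  next
    case (UN K)
    have "{x. (x, 0, x) \<in> \<Union>K} = \<Union>((\<lambda>k. {x. (x, 0, x) \<in> k}) ` K)" by auto
    then show ?case using UN.IH by (auto intro!: openin_Union)
  next
    case (Basis s)
    then obtain U V m n where s: "s = {(x, int m - int n, y) | x y. x \<in> U \<and> y \<in> V \<and>
         (shift E ^^ m) x = (shift E ^^ n) y}" and UV: "openin (bdry_top E) U" "openin (bdry_top E) V"
      by (auto simp: gg_basic_opens_def)
    have "{x. (x, 0, x) \<in> s} = (if m = n then U \<inter> V else {})" unfolding s by auto
    then show ?case using UV by auto
  qed simp
qed

section \<open>From the bispace to a coding and a cocycle\<close>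

theorem theorem11p16:
  fixes H :: "'h groupoid"
    and E :: "('v,'e) graph"
    and Z :: "'z topology"
    and rho :: "'z \<Rightarrow> 'h" and lact :: "'h \<Rightarrow> 'z \<Rightarrow> 'z"
    and sig :: "'z \<Rightarrow> ('v,'e) gg_arrow" and ract :: "'z \<Rightarrow> ('v,'e) gg_arrow \<Rightarrow> 'z"
  assumes "ample H" and "effective H"
    and "second_countable (gtop H)" and "Hausdorff_space (gtop H)"
    and "lc_cantor (unit_top H)"
    and "countable_graph E" and "condition_L E" and "no_sinks E" and "no_semi_tails E"
    and "groupoid_equivalence H (graph_groupoid E) Z rho lact sig ract"
  shows "(\<exists>\<phi>. etale_hom H (graph_groupoid E2) \<phi> \<and> inj_on \<phi> (arrows H)) \<and>
         (compact_space (unit_top H) \<longrightarrow>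
            (\<exists>\<phi>. etale_hom H (graph_groupoid E2) \<phi> \<and> inj_on \<phi> (arrows H) \<and>
                 \<phi> ` units H = units (graph_groupoid E2)))"
proof -
  interpret C: coded_graph E by unfold_locales (use assms in auto)
  let ?G = "graph_groupoid E"
  have H: "etale H" using assms(1) by (simp add: ample_def)
  interpret B: equivalence_bispace H ?G Z rho lact sig ract
    by unfold_locales (use assms(10) etale_openin_units[OF H] C.openin_units_graph_groupoid in auto)
  note Hd = is_groupoidD[OF B.gH]
  have lc: "units H \<noteq> {}" "second_countable (unit_top H)" "Hausdorff_space (unit_top H)"
    "compact_open_basis (unit_top H)"
    using assms(5) by (auto simp: lc_cantor_def)
  \<comment> \<open>Injectivity of \<open>sig\<close> alone would not do: \<open>psi\<close>
    separates boundary paths only if they start at the same vertex.\<close>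
  define P where "P U \<longleftrightarrow> inj_on sig U \<and> (\<exists>v. \<forall>z\<in>U. psource E (fst (sig z)) = v)" for U
  have P: "\<exists>U. openin Z U \<and> z \<in> U \<and> P U" if z: "z \<in> topspace Z" for z
  proof -
    obtain U where U: "openin Z U" "z \<in> U" "inj_on sig U" using B.sig_locally_injective[OF z] by meson
    obtain x where x: "x \<in> bdry E" "sig z = (x, 0, x)"
      using B.sig_in[OF z] by (auto simp: units_graph_groupoid)
    let ?C = "cyl E (psource E x) []"
    let ?V = "{w \<in> topspace Z. sig w \<in> {(y, 0, y) | y. y \<in> ?C}}"
    have "openin (bdry_top E) ?C"
      by (rule C.openin_cyl) (simp add: psource_in_verts[OF assms(6) x(1)])
    from C.openin_unit_space[OF this]
    have oC: "openin (unit_top ?G) ({(y, 0, y) | y. y \<in> ?C} \<inter> units ?G)"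
      unfolding unit_top_def by (rule openin_subtopology_Int)
    have eqV: "?V = {w \<in> topspace Z. sig w \<in> {(y, 0, y) | y. y \<in> ?C} \<inter> units ?G}"
      using B.sig_in by blast
    have "openin Z ?V" unfolding eqV by (rule openin_continuous_map_preimage[OF B.sig_cont oC])
    moreover have "z \<in> ?V" using z x by (simp add: C.cyl_iff zero_enat_def[symmetric])
    moreover have "P (U \<inter> ?V)" unfolding P_def
    proof
      show "inj_on sig (U \<inter> ?V)" using U(3) by (rule inj_on_subset) blast
      show "\<exists>v. \<forall>z\<in>U \<inter> ?V. psource E (fst (sig z)) = v"
        by (rule exI[of _ "psource E x"]) (auto simp: C.cyl_iff)
    qed
    ultimately show ?thesis using U(1,2) by (intro exI[of _ "U \<inter> ?V"]) (simp add: openin_Int)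
  qed
  have mono: "P V" if "P U" "V \<subseteq> U" for U V
    using that unfolding P_def by (blast intro: inj_on_subset)
  obtain s and n :: "'h \<Rightarrow> nat" where
    s: "\<And>u. u \<in> units H \<Longrightarrow> s u \<in> topspace Z" "\<And>u. u \<in> units H \<Longrightarrow> rho (s u) = u"
    and n: "\<And>k. openin (unit_top H) {u \<in> units H. n u = k}"
    and scont: "continuous_map (unit_top H) Z s"
    and sopen: "\<And>V. openin (unit_top H) V \<Longrightarrow> openin Z (s ` V)"
    and sP: "\<And>k. \<exists>U. P U \<and> s ` {u \<in> units H. n u = k} \<subseteq> U"
    by (rule B.piecewise_section[OF lc, of P]) (erule P, erule (1) mono, rule that)
  have sP': "P (s ` {u \<in> units H. n u = k})" for k using sP mono by blast
  define f where "f u = fst (sig (s u))" for u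
  have sigs: "sig (s u) = (f u, 0, f u)" and f_in: "f u \<in> bdry E" if "u \<in> units H" for u
    using B.sig_in[OF s(1)[OF that]] by (auto simp: f_def units_graph_groupoid)
  have fcont: "openin (unit_top H) {u \<in> units H. f u \<in> U}" if U: "openin (bdry_top E) U" for U
  proof -
    have "openin (unit_top ?G) ({(y, 0, y) | y. y \<in> U} \<inter> units ?G)"
      unfolding unit_top_def by (rule openin_subtopology_Int[OF C.openin_unit_space[OF U]])
    from openin_continuous_map_preimage[OF continuous_map_compose[OF scont B.sig_cont] this]
    have "openin (unit_top H) {u \<in> units H. sig (s u) \<in> {(y, 0, y) | y. y \<in> U} \<inter> units ?G}" by simp
    moreover have "{u \<in> units H. sig (s u) \<in> {(y, 0, y) | y. y \<in> U} \<inter> units ?G} = {u \<in> units H. f u \<in> U}"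
      using sigs f_in by (auto simp: units_graph_groupoid)
    ultimately show ?thesis by simp
  qed
  define p where "p u = psi E (f u)" for u
  obtain v where v: "\<And>k u. u \<in> units H \<Longrightarrow> n u = k \<Longrightarrow> psource E (f u) = v k"
  proof -
    have "\<exists>v. \<forall>u\<in>{u \<in> units H. n u = k}. psource E (f u) = v" for k
      using sP'[of k] unfolding P_def f_def by blast
    then have "\<forall>k. \<exists>v. \<forall>u\<in>{u \<in> units H. n u = k}. psource E (f u) = v" ..
    from choice[OF this] obtain v where "\<forall>k. \<forall>u\<in>{u \<in> units H. n u = k}. psource E (f u) = v k" ..
    then show ?thesis by (intro that) simp
  qed
  obtain \<beta> and a b :: "'h \<Rightarrow> nat" where
    \<beta>: "\<And>u i. u \<in> units H \<Longrightarrow> \<beta> u (i + b u) = p u (i + a u)"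
    and ab: "\<And>u. u \<in> units H \<Longrightarrow> \<exists>U. openin (unit_top H) U \<and> u \<in> U \<and> (\<forall>v\<in>U. a v = a u \<and> b v = b u)"
    and \<beta>inj: "inj_on \<beta> (units H)"
    and \<beta>cont: "\<And>u m. u \<in> units H \<Longrightarrow>
      \<exists>U. openin (unit_top H) U \<and> u \<in> U \<and> (\<forall>v\<in>U. \<forall>i<m. \<beta> v i = \<beta> u i)"
    and \<beta>open: "\<And>U. openin (unit_top H) U \<Longrightarrow> seq_open (\<beta> ` U)"
    and \<beta>surj: "compact_space (unit_top H) \<Longrightarrow> units H \<noteq> {} \<Longrightarrow> \<beta> ` units H = UNIV"
  proof (rule cylinder_coding[of "unit_top H" n p, unfolded B.topspace_unit_top])
    show "openin (unit_top H) {u \<in> units H. n u = k}" for k by (rule n)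
    show "\<exists>U. openin (unit_top H) U \<and> u \<in> U \<and> (\<forall>v\<in>U. \<forall>i<m. p v i = p u i)"
      if u: "u \<in> units H" for u m
    proof -
      obtain U where U: "openin (bdry_top E) U" "f u \<in> U" "\<And>y i. y \<in> U \<Longrightarrow> i < m \<Longrightarrow> psi E y i = psi E (f u) i"
        using C.psi_continuous[OF f_in[OF u], of m] by meson
      have "\<forall>v\<in>{u \<in> units H. f u \<in> U}. \<forall>i<m. p v i = p u i" using U(3) unfolding p_def by blast
      moreover have "u \<in> {u \<in> units H. f u \<in> U}" using u U(2) by simp
      ultimately show ?thesis using fcont[OF U(1)] by (intro exI[of _ "{u \<in> units H. f u \<in> U}"] conjI)
    qed
    show "seq_open (p ` {u \<in> V. n u = k})" if V: "openin (unit_top H) V" for V k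
    proof -
      let ?V = "V \<inter> {u \<in> units H. n u = k}"
      have VH: "V \<subseteq> units H" using openin_subset[OF V] by simp
      have "openin (unit_top ?G) (sig ` s ` ?V)"
        using B.sig_open sopen[OF openin_Int[OF V n]] unfolding open_map_def by blast
      then obtain W where W: "openin (gtop ?G) W" "sig ` s ` ?V = W \<inter> units ?G"
        unfolding unit_top_def openin_subtopology by blast
      \<comment> \<open>Openness among the units of the graph groupoid is read as openness among
        boundary paths along the diagonal.\<close>
      have fV: "f ` ?V = {x. (x, 0, x) \<in> W} \<inter> bdry E"
      proof (intro equalityI subsetI)
        fix x assume "x \<in> f ` ?V"
        then obtain u where u: "u \<in> ?V" "x = f u" by blast
        then have "sig (s u) \<in> W" using W(2) by blast
        then show "x \<in> {x. (x, 0, x) \<in> W} \<inter> bdry E" using u sigs f_in by simp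
      next
        fix x assume "x \<in> {x. (x, 0, x) \<in> W} \<inter> bdry E"
        then have "(x, 0, x) \<in> sig ` s ` ?V" using W(2) by (auto simp: units_graph_groupoid)
        then obtain u where "u \<in> ?V" "(x, 0, x) = sig (s u)" by blast
        then show "x \<in> f ` ?V" using sigs[of u] by auto
      qed
      have "openin (bdry_top E) ({x. (x, 0, x) \<in> W} \<inter> bdry E)"
        using openin_diagonal_trace[OF W(1)] C.topspace_bdry openin_topspace[of "bdry_top E"]
        by (intro openin_Int) simp_all
      then have "seq_open (psi E ` {x \<in> f ` ?V. psource E x = v k})"
        unfolding fV by (rule C.seq_open_psi_image)
      \<comment> \<open>The piece lies over one vertex, so restricting the source loses
        nothing.\<close>
      moreover have "{x \<in> f ` ?V. psource E x = v k} = f ` ?V" using v by blast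
      moreover have "psi E ` f ` ?V = p ` {u \<in> V. n u = k}"
        using VH by (auto simp: p_def image_image intro!: image_eqI)
      ultimately show ?thesis by simp
    qed
    show "inj_on p {u \<in> units H. n u = k}" for k
    proof (rule inj_onI)
      fix u w assume u: "u \<in> {u \<in> units H. n u = k}" and w: "w \<in> {u \<in> units H. n u = k}" and "p u = p w"
      then have "f u = f w" using C.psi_inj[of "f u" "f w"] f_in v by (simp add: p_def)
      then have "sig (s u) = sig (s w)" using sigs u w by simp
      then have "s u = s w" using sP'[of k] u w unfolding P_def by (blast dest: inj_onD)
      then show "u = w" using s(2) u w by (metis (mono_tags, lifting) mem_Collect_eq)
    qed
  qed (rule that)
  let ?t = "B.transfer s"
  have sec: "B.unit_section s" using s by (simp add: B.unit_section_def)
  note tr = B.transfer[OF sec]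
  have t_form: "\<exists>k. ?t h = (f (grng H h), k, f (gsrc H h))" if h: "h \<in> arrows H" for h
  proof -
    obtain x k y where xy: "?t h = (x, k, y)" by (cases "?t h")
    show ?thesis
      using tr(2,3)[OF h] sigs[OF Hd(1)[OF h]] sigs[OF Hd(2)[OF h]] unfolding xy by simp
  qed
  \<comment> \<open>Deleting \<open>b u\<close> letters of \<open>\<beta> u\<close> leaves the same
    sequence as deleting \<open>a u\<close> letters of \<open>p u\<close>. Passing from
    \<open>\<beta>\<close> to \<open>p\<close> at the range and back at the source adds
    \<open>b - a\<close> at the range and subtracts it at the source; being a coboundary, this keeps
    the cocycle identity.\<close>
  define c where "c h = int (b (grng H h)) - int (a (grng H h)) + glag E (?t h)
      + int (a (gsrc H h)) - int (b (gsrc H h))" for h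
  have coc: "c (gcomp H g h) = c g + c h" if gh: "(g, h) \<in> composable H" for g h
  proof -
    have g: "g \<in> arrows H" and h: "h \<in> arrows H" and eq: "gsrc H g = grng H h"
      using gh by (auto simp: composable_def)
    obtain k l where kl: "?t g = (f (grng H g), k, f (gsrc H g))" "?t h = (f (gsrc H g), l, f (gsrc H h))"
      using t_form[OF g] t_form[OF h] eq by auto
    have "glag E (?t (gcomp H g h)) = glag E (?t g) + glag E (?t h)"
      using B.transfer_comp(2)[OF sec gh] glag_comp[of _ k _ E l] tr(1)[OF g] tr(1)[OF h]
      by (simp add: kl)
    then show ?thesis unfolding c_def using Hd(10,11)[OF gh] eq by simp
  qed
  \<comment> \<open>With both ends equal the coboundary terms cancel, and \<open>glag\<close> alone
    has to separate the arrows.\<close>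
  have ker: "h = k" if hk: "h \<in> arrows H" "k \<in> arrows H" "grng H h = grng H k" "gsrc H h = gsrc H k" "c h = c k" for h k
  proof (rule B.transfer_inj[OF sec hk(1,2,4,3)])
    obtain l m where "?t h = (f (grng H h), l, f (gsrc H h))" "?t k = (f (grng H h), m, f (gsrc H h))"
      using t_form[OF hk(1)] t_form[OF hk(2)] hk(3,4) by auto
    then show "?t h = ?t k"
      using C.glag_inj[of _ l _ m] tr(1)[OF hk(1)] tr(1)[OF hk(2)] hk(3-5) by (simp add: c_def)
  qed
  have pull: "openin (gtop H) {k \<in> arrows H. grng H k \<in> U}" "openin (gtop H) {k \<in> arrows H. gsrc H k \<in> U}"
    if "openin (unit_top H) U" for U
    using openin_continuous_map_preimage[OF continuous_map_to_unit_top(2)[OF B.tgH] that]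
      openin_continuous_map_preimage[OF continuous_map_to_unit_top(1)[OF B.tgH] that]
    by (simp_all add: B.topH)
  have loc: "\<exists>W M N. openin (gtop H) W \<and> h \<in> W \<and>
      (\<forall>k\<in>W. c k = int M - int N \<and> (\<forall>i. \<beta> (grng H k) (i + M) = \<beta> (gsrc H k) (i + N)))"
    if h: "h \<in> arrows H" for h
  proof -
    let ?r = "grng H h" and ?s = "gsrc H h"
    have "?t h \<in> \<Union>(gg_basic_opens E)"
      using tr(1)[OF h] B.topG unfolding gtop_graph_groupoid topology_generated_by_topspace by simp
    \<comment> \<open>A basic set around the transferred arrow fixes one pair (\<open>m\<close>,
      \<open>n\<close>) for all arrows near \<open>h\<close>.\<close>
    then obtain B where B: "B \<in> gg_basic_opens E" "?t h \<in> B" by blast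
    then obtain U V m n where Bdef: "B = {(x, int m - int n, y) | x y. x \<in> U \<and> y \<in> V \<and>
         (shift E ^^ m) x = (shift E ^^ n) y}"
      and UV: "\<forall>x\<in>U. enat m \<le> plen x" "\<forall>y\<in>V. enat n \<le> plen y"
      by (auto simp: gg_basic_opens_def)
    have "openin (gtop ?G) B"
      unfolding gtop_graph_groupoid using B(1) by (rule topology_generated_by_Basis)
    from B.transfer_continuous[OF sec scont h this B(2)]
    obtain W1 where W1: "openin (gtop H) W1" "h \<in> W1" "\<forall>k\<in>W1. ?t k \<in> B" by blast
    have form: "?t k = (f (grng H k), int m - int n, f (gsrc H k)) \<and>
        gvalid E (f (grng H k)) m n (f (gsrc H k))" if k: "k \<in> W1" for k
    proof -
      have "k \<in> arrows H" using W1(1) k openin_subset B.topH by blast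
      then obtain l where "?t k = (f (grng H k), l, f (gsrc H k))" using t_form by blast
      then show ?thesis using W1(3) k UV by (auto simp: Bdef gvalid_def)
    qed
    note fr = f_in[OF Hd(2)[OF h]] and fs = f_in[OF Hd(1)[OF h]]
    obtain Ua where Ua: "openin (bdry_top E) Ua" "f ?r \<in> Ua" "\<And>y. y \<in> Ua \<Longrightarrow> alen E y m = alen E (f ?r) m"
      using C.alen_locally_constant[OF fr, of m] form[OF W1(2)] unfolding gvalid_def by meson
    obtain Va where Va: "openin (bdry_top E) Va" "f ?s \<in> Va" "\<And>y. y \<in> Va \<Longrightarrow> alen E y n = alen E (f ?s) n"
      using C.alen_locally_constant[OF fs, of n] form[OF W1(2)] unfolding gvalid_def by meson
    obtain Ub where Ub: "openin (unit_top H) Ub" "?r \<in> Ub" "\<And>v. v \<in> Ub \<Longrightarrow> a v = a ?r \<and> b v = b ?r"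
      using ab[OF Hd(2)[OF h]] by meson
    obtain Vb where Vb: "openin (unit_top H) Vb" "?s \<in> Vb" "\<And>v. v \<in> Vb \<Longrightarrow> a v = a ?s \<and> b v = b ?s"
      using ab[OF Hd(1)[OF h]] by meson
    define W where "W = W1 \<inter> {k \<in> arrows H. grng H k \<in> {u \<in> units H. f u \<in> Ua}} \<inter>
       {k \<in> arrows H. gsrc H k \<in> {u \<in> units H. f u \<in> Va}} \<inter>
       {k \<in> arrows H. grng H k \<in> Ub} \<inter> {k \<in> arrows H. gsrc H k \<in> Vb}"
    \<comment> \<open>At the range, \<open>b ?r\<close> letters of \<open>\<beta>\<close> correspond
      to \<open>a ?r\<close> letters of \<open>p\<close>, and vice versa at the source. The extra
      \<open>a ?s\<close> in \<open>M\<close> and \<open>a ?r\<close> in \<open>N\<close> give both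
      sides the same offset \<open>a ?r + a ?s\<close> beyond the deleted edge words, where
      \<open>psi_gvalid\<close> compares them.\<close>
    define M where "M = alen E (f ?r) m + a ?s + b ?r"
    define N where "N = alen E (f ?s) n + a ?r + b ?s"
    have "openin (gtop H) W"
      unfolding W_def by (intro openin_Int W1 pull fcont Ua Va Ub Vb)
    moreover have "h \<in> W" unfolding W_def using h W1 Ua Va Ub Vb Hd(1,2) by simp
    moreover have "c k = int M - int N \<and> (\<forall>i. \<beta> (grng H k) (i + M) = \<beta> (gsrc H k) (i + N))" if k: "k \<in> W" for k
    proof
      let ?r' = "grng H k" and ?s' = "gsrc H k"
      have kW: "k \<in> arrows H" "k \<in> W1" and al: "alen E (f ?r') m = alen E (f ?r) m" "alen E (f ?s') n = alen E (f ?s) n"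
        and ab': "a ?r' = a ?r" "b ?r' = b ?r" "a ?s' = a ?s" "b ?s' = b ?s"
        using k Ua(3) Va(3) Ub(3) Vb(3) by (auto simp: W_def)
      have gv: "gvalid E (f ?r') m n (f ?s')" using form[OF kW(2)] by simp
      show "c k = int M - int N"
        using glag_eq[OF gv] form[OF kW(2)] by (simp add: c_def M_def N_def al ab')
      show "\<forall>i. \<beta> ?r' (i + M) = \<beta> ?s' (i + N)"
      proof
        fix i
        have "\<beta> ?r' (i + M) = \<beta> ?r' (i + alen E (f ?r') m + a ?s' + b ?r')"
          by (simp add: M_def al ab' add.assoc)
        also have "\<dots> = p ?r' (i + alen E (f ?r') m + a ?s' + a ?r')"
          by (rule \<beta>[OF Hd(2)[OF kW(1)]])
        also have "\<dots> = psi E (f ?r') ((i + a ?s' + a ?r') + alen E (f ?r') m)"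
          unfolding p_def by (simp only: ac_simps)
        also have "\<dots> = psi E (f ?s') ((i + a ?s' + a ?r') + alen E (f ?s') n)"
          by (rule psi_gvalid[OF gv])
        also have "\<dots> = p ?s' (i + alen E (f ?s') n + a ?r' + a ?s')"
          unfolding p_def by (simp only: ac_simps)
        also have "\<dots> = \<beta> ?s' (i + alen E (f ?s') n + a ?r' + b ?s')"
          by (rule \<beta>[OF Hd(1)[OF kW(1)], symmetric])
        also have "\<dots> = \<beta> ?s' (i + N)" by (simp add: N_def al ab' add.assoc)
        finally show "\<beta> ?r' (i + M) = \<beta> ?s' (i + N)" .
      qed
    qed
    ultimately have "openin (gtop H) W \<and> h \<in> W \<and>
        (\<forall>k\<in>W. c k = int M - int N \<and> (\<forall>i. \<beta> (grng H k) (i + M) = \<beta> (gsrc H k) (i + N)))"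
      by (intro conjI ballI) simp_all
    then show ?thesis by (intro exI)
  qed
  have emb: "etale_hom H (graph_groupoid E2) (cocycle_map H \<beta> c)"
    by (rule etale_hom_cocycle_map(1); fact)
  have emb_inj: "inj_on (cocycle_map H \<beta> c) (arrows H)"
    by (rule etale_hom_cocycle_map(2); fact)
  have emb_units: "cocycle_map H \<beta> c ` units H = units (graph_groupoid E2)" if "\<beta> ` units H = UNIV"
    by (rule etale_hom_cocycle_map(3); fact)
  show ?thesis
  proof (intro conjI impI exI)
    show "etale_hom H (graph_groupoid E2) (cocycle_map H \<beta> c)" "inj_on (cocycle_map H \<beta> c) (arrows H)"
      by (rule emb emb_inj)+
    show "etale_hom H (graph_groupoid E2) (cocycle_map H \<beta> c)" "inj_on (cocycle_map H \<beta> c) (arrows H)"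
      by (rule emb emb_inj)+
    assume "compact_space (unit_top H)"
    then show "cocycle_map H \<beta> c ` units H = units (graph_groupoid E2)"
      by (intro emb_units \<beta>surj lc(1))
  qed
qed

end
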